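(* Let $X=C^{0,\alpha}[a,b]$ with $0<\alpha\le1$, or $X=W^{1,p}(a,b)$ with $1<p\le\infty$. Let $\varphi(u)=\max_{s\in[a,b]}u(s)$. Then the set-valued mapping $\Phi=(\partial\varphi)|_X$, $$\Phi(u)=\{\mu\in C[a,b]^*:\ \operatorname{supp}(\mu)\subset M(u),\ \mu\ge0,\ \|\mu\|=1\},\qquad u\in X,$$ is a globally bounded Newton derivative of the maximum functional $\varphi$ on $X$. In particular, for every $u\in X$ there exists a nondecreasing and bounded $\rho_u:\mathbb{R}_+\to\mathbb{R}_+$ such that $\rho_u(\delta)\to0$ as $\delta\to0$, $\rho_u$ is bounded independently of $u$, and $$|\varphi(u+h)-\varphi(u)-Lh|\le\rho_u(\|h\|_\infty)\,|h|_{C^{0,\alpha}},\quad\text{respectively}\quad|\varphi(u+h)-\varphi(u)-Lh|\le\rho_u(\|h\|_\infty)\,\|h'\|_{L^p},$$ for every $h\in X$ and every $L\in\Phi(u+h)$. Moreover, $\varphi$ is Bouligand differentiable on $X$, and for every $u\in X$ $$|\varphi(u+h)-\varphi(u)-\varphi'(u;h)|\le\rho_u(\|h\|_\infty)\,|h|_{C^{0,\alpha}},\quad\text{respectively}\quad|\varphi(u+h)-\varphi(u)-\varphi'(u;h)|\le\rho_u(\|h\|_\infty)\,\|h'\|_{L^p},$$ for every $h\in X$.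
   Context: Norms: $\|u\|_{C^{0,\alpha}}=|u(a)|+|u|_{C^{0,\alpha}}$ with $|u|_{C^{0,\alpha}}=\sup_{s\ne t}|u(t)-u(s)|/|t-s|^\alpha$; $\|u\|_{W^{1,p}}=|u(a)|+\|u'\|_{L^p}$; $\|\cdot\|_\infty$ is the maximum norm. $M(u)=\{\tau\in[a,b]:u(\tau)=\varphi(u)\}$. $C[a,b]^*$ is the space of signed regular Borel measures on $[a,b]$; its elements are regarded as elements of $\mathcal{L}(X,\mathbb{R})$ by restriction. $\varphi'(u;h)=\max_{s\in M(u)}h(s)$ is the directional derivative of $\varphi$. For normed spaces $A,B$, $U\subset A$ open and $F:U\to B$, a set-valued map $G$ from $U$ to nonempty subsets of $\mathcal{L}(A,B)$ (continuous linear maps) is a Newton derivative of $F$ in $U$ if $\lim_{h\to0}\sup_{L\in G(u+h)}\|F(u+h)-F(u)-Lh\|/\|h\|=0$ for every $u\in U$. It is globally bounded if there are bounds for the sets $\{\|L\|:L\in G(v),\ \|v-u\|\le\delta(u)\}$ that are independent of $u$. $F$ is Bouligand differentiable at $u$ if the directional derivative $F'(u;h)=\lim_{\lambda\downarrow0}(F(u+\lambda h)-F(u))/\lambda$ exists for all $h$ and $\|F(u+h)-F(u)-F'(u;h)\|/\|h\|\to0$ as $h\to0$. *)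

theory Defs
  imports "HOL-Analysis.Analysis" "HOL-Probability.Essential_Supremum"
    "HOL-Library.Function_Algebras"
begin

text \<open>Pointwise real vector space structure on functions; addition, subtraction and zero are
  those of \<^theory>\<open>HOL-Library.Function_Algebras\<close>.\<close>

instantiation "fun" :: (type, real_vector) real_vector
begin

definition scaleR_fun :: "real \<Rightarrow> ('a \<Rightarrow> 'b) \<Rightarrow> 'a \<Rightarrow> 'b"
  where "scaleR_fun c f = (\<lambda>x. c *\<^sub>R f x)"

instance
  by standard (auto simp: scaleR_fun_def fun_eq_iff algebra_simps)

end

section \<open>Normed spaces with explicit carrier\<close>

text \<open>The spaces under consideration depend on real parameters, so a normed space is given by
  a linear subspace \<open>A\<close> of a real vector space together with a norm \<open>N\<close> on \<open>A\<close>. The target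
  space \<open>B\<close> of the maps is a type of class \<^class>\<open>real_normed_vector\<close>.\<close>

definition open_in_normed :: "'a::real_vector set \<Rightarrow> ('a \<Rightarrow> real) \<Rightarrow> 'a set \<Rightarrow> bool" where
  "open_in_normed A N U \<longleftrightarrow>
     U \<subseteq> A \<and> (\<forall>u\<in>U. \<exists>e>0. \<forall>v\<in>A. N (v - u) < e \<longrightarrow> v \<in> U)"

text \<open>The filter of \<open>h \<rightarrow> 0\<close>, \<open>h \<noteq> 0\<close>, in the norm \<open>N\<close> on \<open>A\<close>.\<close>

definition at_zero :: "'a::real_vector set \<Rightarrow> ('a \<Rightarrow> real) \<Rightarrow> 'a filter" where
  "at_zero A N = (INF e\<in>{0<..}. principal {h \<in> A. h \<noteq> 0 \<and> N h < e})"

text \<open>The continuous linear maps from \<open>A\<close> to \<open>B\<close>. They are made extensional, so that maps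
  which agree on \<open>A\<close> are equal.\<close>

definition continuous_linear_maps ::
    "'a::real_vector set \<Rightarrow> ('a \<Rightarrow> real) \<Rightarrow> ('a \<Rightarrow> 'b::real_normed_vector) set" where
  "continuous_linear_maps A N =
     {L \<in> extensional A.
        (\<forall>x\<in>A. \<forall>y\<in>A. L (x + y) = L x + L y) \<and>
        (\<forall>c. \<forall>x\<in>A. L (c *\<^sub>R x) = c *\<^sub>R L x) \<and>
        (\<exists>C. \<forall>x\<in>A. norm (L x) \<le> C * N x)}"

definition operator_norm ::
    "'a::real_vector set \<Rightarrow> ('a \<Rightarrow> real) \<Rightarrow> ('a \<Rightarrow> 'b::real_normed_vector) \<Rightarrow> real" where
  "operator_norm A N L = (SUP x\<in>A. norm (L x) / N x)"

section \<open>Newton and Bouligand derivatives, subdifferential\<close>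

definition newton_derivative ::
    "'a::real_vector set \<Rightarrow> ('a \<Rightarrow> real) \<Rightarrow> 'a set \<Rightarrow> ('a \<Rightarrow> 'b::real_normed_vector)
      \<Rightarrow> ('a \<Rightarrow> ('a \<Rightarrow> 'b) set) \<Rightarrow> bool" where
  "newton_derivative A N U F G \<longleftrightarrow>
     open_in_normed A N U \<and>
     (\<forall>u\<in>U. G u \<noteq> {} \<and> G u \<subseteq> continuous_linear_maps A N) \<and>
     (\<forall>u\<in>U. ((\<lambda>h. SUP L\<in>G (u + h). ereal (norm (F (u + h) - F u - L h) / N h)) \<longlongrightarrow> 0)
               (at_zero A N))"

definition globally_bounded ::
    "'a::real_vector set \<Rightarrow> ('a \<Rightarrow> real) \<Rightarrow> 'a set
      \<Rightarrow> ('a \<Rightarrow> ('a \<Rightarrow> 'b::real_normed_vector) set) \<Rightarrow> bool" where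
  "globally_bounded A N U G \<longleftrightarrow>
     (\<exists>C. \<forall>u\<in>U. \<exists>\<delta>>0. \<forall>v\<in>U. N (v - u) \<le> \<delta> \<longrightarrow> (\<forall>L\<in>G v. operator_norm A N L \<le> C))"

definition has_dir_derivative ::
    "('a::real_vector \<Rightarrow> 'b::real_normed_vector) \<Rightarrow> 'a \<Rightarrow> 'a \<Rightarrow> 'b \<Rightarrow> bool" where
  "has_dir_derivative F u h d \<longleftrightarrow>
     ((\<lambda>t. (F (u + t *\<^sub>R h) - F u) /\<^sub>R t) \<longlongrightarrow> d) (at_right 0)"

definition dir_derivative ::
    "('a::real_vector \<Rightarrow> 'b::real_normed_vector) \<Rightarrow> 'a \<Rightarrow> 'a \<Rightarrow> 'b" where
  "dir_derivative F u h = (THE d. has_dir_derivative F u h d)"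

definition bouligand_differentiable_at ::
    "'a::real_vector set \<Rightarrow> ('a \<Rightarrow> real) \<Rightarrow> ('a \<Rightarrow> 'b::real_normed_vector) \<Rightarrow> 'a \<Rightarrow> bool" where
  "bouligand_differentiable_at A N F u \<longleftrightarrow>
     (\<forall>h\<in>A. \<exists>d. has_dir_derivative F u h d) \<and>
     ((\<lambda>h. norm (F (u + h) - F u - dir_derivative F u h) / N h) \<longlongrightarrow> 0) (at_zero A N)"

definition subdifferential ::
    "'a::real_vector set \<Rightarrow> ('a \<Rightarrow> real) \<Rightarrow> ('a \<Rightarrow> real) \<Rightarrow> 'a \<Rightarrow> ('a \<Rightarrow> real) set" where
  "subdifferential A N f u =
     {L \<in> continuous_linear_maps A N. \<forall>v\<in>A. f u + L (v - u) \<le> f v}"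

section \<open>Function spaces on an interval\<close>

text \<open>A function on \<open>[a,b]\<close> is represented by the function on the real line which extends it
  by \<open>0\<close>. All norms below only look at the values on \<open>[a,b]\<close>.\<close>

definition C_space :: "real \<Rightarrow> real \<Rightarrow> (real \<Rightarrow> real) set" where
  "C_space a b = {u. continuous_on {a..b} u \<and> (\<forall>t. t \<notin> {a..b} \<longrightarrow> u t = 0)}"

definition max_norm :: "real \<Rightarrow> real \<Rightarrow> (real \<Rightarrow> real) \<Rightarrow> real" where
  "max_norm a b u = (SUP t\<in>{a..b}. \<bar>u t\<bar>)"

definition holder_quotients :: "real \<Rightarrow> real \<Rightarrow> real \<Rightarrow> (real \<Rightarrow> real) \<Rightarrow> real set" where
  "holder_quotients a b \<alpha> u =
     {\<bar>u t - u s\<bar> / \<bar>t - s\<bar> powr \<alpha> | s t. s \<in> {a..b} \<and> t \<in> {a..b} \<and> s \<noteq> t}"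

definition holder_seminorm :: "real \<Rightarrow> real \<Rightarrow> real \<Rightarrow> (real \<Rightarrow> real) \<Rightarrow> real" where
  "holder_seminorm a b \<alpha> u = Sup (holder_quotients a b \<alpha> u)"

definition holder_space :: "real \<Rightarrow> real \<Rightarrow> real \<Rightarrow> (real \<Rightarrow> real) set" where
  "holder_space a b \<alpha> = {u \<in> C_space a b. bdd_above (holder_quotients a b \<alpha> u)}"

definition holder_norm :: "real \<Rightarrow> real \<Rightarrow> real \<Rightarrow> (real \<Rightarrow> real) \<Rightarrow> real" where
  "holder_norm a b \<alpha> u = \<bar>u a\<bar> + holder_seminorm a b \<alpha> u"

definition Lp_fun :: "'a measure \<Rightarrow> ennreal \<Rightarrow> ('a \<Rightarrow> real) \<Rightarrow> bool" where
  "Lp_fun M p g \<longleftrightarrow> g \<in> borel_measurable M \<and>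
     (if p = \<infinity> then \<exists>C. AE x in M. \<bar>g x\<bar> \<le> C
      else integrable M (\<lambda>x. \<bar>g x\<bar> powr enn2real p))"

definition Lp_norm :: "'a measure \<Rightarrow> ennreal \<Rightarrow> ('a \<Rightarrow> real) \<Rightarrow> real" where
  "Lp_norm M p g =
     (if p = \<infinity> then real_of_ereal (esssup M (\<lambda>x. ereal \<bar>g x\<bar>))
      else (LINT x|M. \<bar>g x\<bar> powr enn2real p) powr (1 / enn2real p))"

text \<open>Test functions in \<open>C\<^sub>c\<^sup>1(a,b)\<close>.\<close>

definition test_function :: "real \<Rightarrow> real \<Rightarrow> (real \<Rightarrow> real) \<Rightarrow> bool" where
  "test_function a b \<eta> \<longleftrightarrow>
     \<eta> differentiable_on UNIV \<and> continuous_on UNIV (deriv \<eta>) \<and>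
     (\<exists>K. compact K \<and> K \<subseteq> {a<..<b} \<and> (\<forall>t. t \<notin> K \<longrightarrow> \<eta> t = 0))"

definition has_weak_derivative ::
    "real \<Rightarrow> real \<Rightarrow> ennreal \<Rightarrow> (real \<Rightarrow> real) \<Rightarrow> (real \<Rightarrow> real) \<Rightarrow> bool" where
  "has_weak_derivative a b p u g \<longleftrightarrow>
     Lp_fun (lebesgue_on {a<..<b}) p g \<and>
     (\<forall>\<eta>. test_function a b \<eta> \<longrightarrow>
        (LINT t|lebesgue_on {a<..<b}. u t * deriv \<eta> t) =
        - (LINT t|lebesgue_on {a<..<b}. g t * \<eta> t))"

text \<open>Elements of \<open>W\<^sup>1\<^sup>,\<^sup>p(a,b)\<close> are identified with their continuous representatives on \<open>[a,b]\<close>.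
  These are bounded, hence automatically in \<open>L\<^sup>p\<close>.\<close>

definition sobolev_space :: "real \<Rightarrow> real \<Rightarrow> ennreal \<Rightarrow> (real \<Rightarrow> real) set" where
  "sobolev_space a b p = {u \<in> C_space a b. \<exists>g. has_weak_derivative a b p u g}"

text \<open>The weak derivative is unique only almost everywhere; the \<open>L\<^sup>p\<close> norm does not depend on
  the choice.\<close>

definition weak_derivative :: "real \<Rightarrow> real \<Rightarrow> ennreal \<Rightarrow> (real \<Rightarrow> real) \<Rightarrow> real \<Rightarrow> real" where
  "weak_derivative a b p u = (SOME g. has_weak_derivative a b p u g)"

definition sobolev_seminorm :: "real \<Rightarrow> real \<Rightarrow> ennreal \<Rightarrow> (real \<Rightarrow> real) \<Rightarrow> real" where
  "sobolev_seminorm a b p u = Lp_norm (lebesgue_on {a<..<b}) p (weak_derivative a b p u)"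

definition sobolev_norm :: "real \<Rightarrow> real \<Rightarrow> ennreal \<Rightarrow> (real \<Rightarrow> real) \<Rightarrow> real" where
  "sobolev_norm a b p u = \<bar>u a\<bar> + sobolev_seminorm a b p u"

section \<open>The maximum functional\<close>

text \<open>The supremum is attained, as the functional is only used for continuous \<open>u\<close>.\<close>

definition max_functional :: "real \<Rightarrow> real \<Rightarrow> (real \<Rightarrow> real) \<Rightarrow> real" where
  "max_functional a b u = (SUP s\<in>{a..b}. u s)"

definition max_set :: "real \<Rightarrow> real \<Rightarrow> (real \<Rightarrow> real) \<Rightarrow> real set" where
  "max_set a b u = {\<tau> \<in> {a..b}. u \<tau> = max_functional a b u}"

definition borel_support :: "real measure \<Rightarrow> real set" where
  "borel_support \<mu> =
     {t \<in> space \<mu>. \<forall>V. open V \<longrightarrow> t \<in> V \<longrightarrow> emeasure \<mu> (V \<inter> space \<mu>) > 0}"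

text \<open>Elements \<open>\<mu> \<ge> 0\<close> of \<open>C[a,b]\<^sup>*\<close> are finite Borel measures on \<open>[a,b]\<close> (regularity is automatic
  there), and their norm, the total variation, is \<open>\<mu>([a,b])\<close>.\<close>

definition max_measures :: "real \<Rightarrow> real \<Rightarrow> (real \<Rightarrow> real) \<Rightarrow> real measure set" where
  "max_measures a b u =
     {\<mu>. sets \<mu> = sets (restrict_space borel {a..b}) \<and>
         borel_support \<mu> \<subseteq> max_set a b u \<and> emeasure \<mu> {a..b} = 1}"

text \<open>The measures as functionals, restricted to \<open>X\<close>.\<close>

definition max_derivative ::
    "real \<Rightarrow> real \<Rightarrow> (real \<Rightarrow> real) set \<Rightarrow> (real \<Rightarrow> real) \<Rightarrow> ((real \<Rightarrow> real) \<Rightarrow> real) set" where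
  "max_derivative a b X u =
     (\<lambda>\<mu>. restrict (\<lambda>h. LINT s|\<mu>. h s) X) ` max_measures a b u"

end

theory Submission
  imports Defs "HOL-Probability.Helly_Selection" "HOL-Probability.Giry_Monad"
begin

text \<open>
  Both spaces embed into a Hoelder space: \<open>\<bar>h t - h s\<bar> \<le> S h * \<bar>t - s\<bar> powr \<beta>\<close> for some \<open>\<beta> > 0\<close>
  (\<open>\<beta> = 1 - 1/p\<close> in the Sobolev case). A point \<open>t\<close> maximising \<open>u + h\<close> satisfies
  \<open>u t \<ge> max u - 2 \<parallel>h\<parallel>\<close> in the maximum norm, hence its distance to a nearest maximiser \<open>\<tau>\<close> of \<open>u\<close>
  is at most some \<open>r\<close> depending on \<open>u\<close> and \<open>\<parallel>h\<parallel>\<close> only, which tends to zero with \<open>\<parallel>h\<parallel>\<close> by compactness.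
  Comparing \<open>u + h\<close> at \<open>t\<close> and at \<open>\<tau>\<close> bounds the linearisation errors by
  \<open>\<bar>h t - h \<tau>\<bar> \<le> S h * r powr \<beta>\<close>, for the Newton derivative after integration over the maximisers
  \<open>t\<close> of \<open>u + h\<close> with respect to the measure. A subgradient on \<open>C[a,b]\<close> is a positive functional of
  mass one, which Riesz' theorem represents by a probability measure on the maximum set.
\<close>

section \<open>Maximisers under perturbation\<close>

text \<open>Compactness yields no rate for \<open>r\<close> in terms of the size of
  \<open>h\<close>, so the modulus is only qualitative. First order smallness comes from the factor
  \<open>S h\<close>, which is at most the norm of \<open>h\<close>; it remains that
  \<open>r powr \<beta>\<close> tends to zero, and this is where \<beta> > 0, hence p > 1 in the
  Sobolev case, enters. Both linearisation errors have a sign. With L taken at u + h the error is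
  the integral of u - max u and thus nonpositive; with the directional derivative at u it is
  nonnegative. Only the other side calls for the comparison of the points t and \<tau>. In the
  Sobolev case the Hoelder bound has to carry the norm of the very weak derivative that
  \<open>SOME\<close> selects. The increments of a function are therefore bounded directly from the
  integration by parts identity, applied to whichever derivative is given. The set \<Phi>(u)
  consists of restrictions to X of subgradients on C[a,b], so the subdifferential is computed on the
  large space, where Riesz' theorem is available.\<close>

lemma C_space_continuous: "u \<in> C_space a b \<Longrightarrow> continuous_on {a..b} u"
  by (simp add: C_space_def)

lemma C_space_add: "u \<in> C_space a b \<Longrightarrow> v \<in> C_space a b \<Longrightarrow> u + v \<in> C_space a b"
  by (auto simp: C_space_def plus_fun_def intro!: continuous_intros)

lemma C_space_scale: "u \<in> C_space a b \<Longrightarrow> c *\<^sub>R u \<in> C_space a b"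
  by (auto simp: C_space_def scaleR_fun_def intro!: continuous_intros)

text \<open>The constant function 1 in the representation by zero extension; the mass of a
  functional is its value here.\<close>

lemma C_space_indicator: "indicator {a..b} \<in> C_space a b"
  unfolding C_space_def using continuous_on_cong[of "{a..b}" "{a..b}" "indicator {a..b}" "\<lambda>_. 1 :: real"]
  by (auto simp: continuous_on_const)

lemma continuous_interval_bdd:
  fixes u :: "real \<Rightarrow> real"
  assumes "continuous_on {a..b} u"
  shows "bdd_above (u ` {a..b})" "bdd_below (u ` {a..b})"
  using compact_continuous_image[OF assms compact_Icc]
  by (auto intro: bounded_imp_bdd_above bounded_imp_bdd_below compact_imp_bounded)

lemma max_functional_upper:
  assumes "continuous_on {a..b} u" "t \<in> {a..b}"
  shows "u t \<le> max_functional a b u"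
  unfolding max_functional_def by (intro cSUP_upper assms continuous_interval_bdd)

lemma max_functional_least:
  assumes "a \<le> b" "\<And>t. t \<in> {a..b} \<Longrightarrow> u t \<le> c"
  shows "max_functional a b u \<le> c"
  unfolding max_functional_def using assms by (intro cSUP_least) auto

lemma max_functional_attained:
  assumes "a \<le> b" "continuous_on {a..b} u"
  shows "\<exists>t\<in>{a..b}. u t = max_functional a b u"
proof -
  obtain t where "t \<in> {a..b}" "\<forall>y\<in>{a..b}. u y \<le> u t"
    using continuous_attains_sup[of "{a..b}" u] assms by auto
  moreover from this have "u t = max_functional a b u"
    by (intro antisym max_functional_upper max_functional_least assms) auto
  ultimately show ?thesis by blast
qed

lemma max_set_nonempty:
  "a \<le> b \<Longrightarrow> continuous_on {a..b} u \<Longrightarrow> max_set a b u \<noteq> {}"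
  using max_functional_attained[of a b u] by (auto simp: max_set_def)

lemma compact_max_set:
  assumes "continuous_on {a..b} u"
  shows "compact (max_set a b u)"
proof -
  have "closed (max_set a b u)"
    unfolding max_set_def by (rule continuous_closed_preimage_constant[OF assms closed_atLeastAtMost])
  then have "compact ({a..b} \<inter> max_set a b u)"
    by (rule compact_Int_closed[OF compact_Icc])
  moreover have "{a..b} \<inter> max_set a b u = max_set a b u"
    by (auto simp: max_set_def)
  ultimately show ?thesis by simp
qed

lemma max_norm_upper:
  assumes "continuous_on {a..b} h" "t \<in> {a..b}"
  shows "\<bar>h t\<bar> \<le> max_norm a b h"
  unfolding max_norm_def
  by (rule cSUP_upper[OF assms(2)]) (intro continuous_interval_bdd continuous_intros assms)

lemma max_norm_least:
  assumes "a \<le> b" "\<And>t. t \<in> {a..b} \<Longrightarrow> \<bar>h t\<bar> \<le> c"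
  shows "max_norm a b h \<le> c"
  unfolding max_norm_def using assms by (intro cSUP_least) auto

lemma max_norm_nonneg:
  assumes "a \<le> b" "continuous_on {a..b} h"
  shows "0 \<le> max_norm a b h"
  using max_norm_upper[OF assms(2), of a] assms(1) by auto

text \<open>The one-sided Hausdorff distance from a superlevel set of \<open>u\<close> to its
  maximum set. The factor 2 arises because a perturbation of size \<delta> can lift \<open>u\<close>
  at one point by \<delta> and lower it at a maximiser by \<delta>.\<close>

definition max_set_excess :: "real \<Rightarrow> real \<Rightarrow> (real \<Rightarrow> real) \<Rightarrow> real \<Rightarrow> real" where
  "max_set_excess a b u \<delta> =
     (SUP t\<in>{t \<in> {a..b}. max_functional a b u - 2 * \<delta> \<le> u t}. infdist t (max_set a b u))"

context
  fixes a b :: real and u :: "real \<Rightarrow> real"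
  assumes ab: "a \<le> b" and cont: "continuous_on {a..b} u"
begin

lemma infdist_max_set_le:
  assumes "t \<in> {a..b}"
  shows "infdist t (max_set a b u) \<le> b - a"
proof -
  obtain s where s: "s \<in> max_set a b u"
    using max_set_nonempty[OF ab cont] by auto
  have "infdist t (max_set a b u) \<le> dist t s"
    by (rule infdist_le[OF s])
  also have "\<dots> \<le> b - a"
    using s assms by (auto simp: max_set_def dist_real_def)
  finally show ?thesis .
qed

lemma max_set_excess_bdd:
  "bdd_above ((\<lambda>t. infdist t (max_set a b u)) ` {t \<in> {a..b}. max_functional a b u - 2 * \<delta> \<le> u t})"
  by (rule bdd_aboveI[of _ "b - a"]) (auto simp: infdist_max_set_le)

lemma max_set_excess_ne:
  "0 \<le> \<delta> \<Longrightarrow> {t \<in> {a..b}. max_functional a b u - 2 * \<delta> \<le> u t} \<noteq> {}"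
  using max_functional_attained[OF ab cont] by force

lemma infdist_le_max_set_excess:
  assumes "t \<in> {a..b}" "max_functional a b u - 2 * \<delta> \<le> u t"
  shows "infdist t (max_set a b u) \<le> max_set_excess a b u \<delta>"
  unfolding max_set_excess_def
  by (rule cSUP_upper[OF _ max_set_excess_bdd]) (use assms in auto)

lemma max_set_excess_nonneg:
  assumes "0 \<le> \<delta>"
  shows "0 \<le> max_set_excess a b u \<delta>"
proof -
  obtain t where "t \<in> {a..b}" "max_functional a b u - 2 * \<delta> \<le> u t"
    using max_set_excess_ne[OF assms] by auto
  then show ?thesis
    using infdist_le_max_set_excess infdist_nonneg order_trans by blast
qed

lemma max_set_excess_le:
  "0 \<le> \<delta> \<Longrightarrow> max_set_excess a b u \<delta> \<le> b - a"
  unfolding max_set_excess_def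
  by (rule cSUP_least[OF max_set_excess_ne]) (auto intro: infdist_max_set_le)

lemma max_set_excess_mono: "mono_on {0..} (max_set_excess a b u)"
  unfolding max_set_excess_def
  by (intro mono_onI cSUP_subset_mono max_set_excess_bdd max_set_excess_ne) auto

text \<open>Off an \<open>\<epsilon>\<close>-neighbourhood of the maximum set, \<open>u\<close> stays below its maximum by a
  positive amount, by compactness.\<close>

lemma max_set_excess_tendsto: "(max_set_excess a b u \<longlongrightarrow> 0) (at_right 0)"
proof (rule tendstoI)
  fix \<epsilon> :: real assume "0 < \<epsilon>"
  define K where "K = {a..b} \<inter> {t. \<epsilon> / 2 \<le> infdist t (max_set a b u)}"
  have "compact K"
    unfolding K_def by (intro compact_Int_closed closed_Collect_le continuous_intros compact_Icc)
  have "\<exists>d>0. \<forall>t\<in>K. u t < max_functional a b u - 2 * d"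
  proof (cases "K = {}")
    case True
    then show ?thesis by (auto intro: exI[of _ 1])
  next
    case False
    have "continuous_on K u"
      by (rule continuous_on_subset[OF cont]) (simp add: K_def)
    then obtain s where s: "s \<in> K" "\<forall>t\<in>K. u t \<le> u s"
      using continuous_attains_sup[OF \<open>compact K\<close> False] by blast
    have "s \<notin> max_set a b u"
      using s(1) \<open>0 < \<epsilon>\<close> by (auto simp: K_def)
    moreover have "s \<in> {a..b}" using s(1) by (simp add: K_def)
    ultimately have *: "u s < max_functional a b u"
      using max_functional_upper[OF cont, of s] by (simp add: max_set_def)
    \<comment> \<open>A quarter of the gap: \<open>2 * d\<close> is then half of it, which keeps the
      inequality strict.\<close>
    define d where "d = (max_functional a b u - u s) / 4"
    have "0 < d" "u s < max_functional a b u - 2 * d"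
      using * by (simp_all add: d_def field_simps)
    then show ?thesis
      using s(2) order_le_less_trans by blast
  qed
  then obtain d where d: "0 < d" "\<And>t. t \<in> K \<Longrightarrow> u t < max_functional a b u - 2 * d"
    by blast
  have "dist (max_set_excess a b u \<delta>) 0 < \<epsilon>" if \<delta>: "0 < \<delta>" "\<delta> < d" for \<delta>
  proof -
    have "max_set_excess a b u \<delta> \<le> \<epsilon> / 2"
      unfolding max_set_excess_def
    proof (rule cSUP_least[OF max_set_excess_ne])
      fix t assume t: "t \<in> {t \<in> {a..b}. max_functional a b u - 2 * \<delta> \<le> u t}"
      then have "t \<notin> K" using d(2)[of t] \<delta> by auto
      with t show "infdist t (max_set a b u) \<le> \<epsilon> / 2" by (auto simp: K_def)
    qed (use \<delta> in simp)
    then show ?thesis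
      using max_set_excess_nonneg[of \<delta>] \<delta> \<open>0 < \<epsilon>\<close> by simp
  qed
  then show "\<forall>\<^sub>F \<delta> in at_right 0. dist (max_set_excess a b u \<delta>) 0 < \<epsilon>"
    using d(1) by (auto simp: eventually_at_right_field)
qed

lemma max_set_perturbed_near:
  assumes h: "continuous_on {a..b} h" and t: "t \<in> max_set a b (u + h)"
    and \<delta>: "max_norm a b h \<le> \<delta>"
  shows "\<exists>\<tau>\<in>max_set a b u. \<bar>t - \<tau>\<bar> \<le> max_set_excess a b u \<delta>"
proof -
  have c: "continuous_on {a..b} (u + h)"
    unfolding plus_fun_def by (intro continuous_intros cont h)
  obtain s where s: "s \<in> {a..b}" "u s = max_functional a b u"
    using max_functional_attained[OF ab cont] by blast
  have t': "t \<in> {a..b}" "u t + h t = max_functional a b (u + h)"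
    using t by (auto simp: max_set_def)
  have "u s + h s \<le> u t + h t"
    using max_functional_upper[OF c s(1)] t' by simp
  then have "max_functional a b u - 2 * \<delta> \<le> u t"
    using max_norm_upper[OF h s(1)] max_norm_upper[OF h t'(1)] s \<delta> by linarith
  then have "infdist t (max_set a b u) \<le> max_set_excess a b u \<delta>"
    by (rule infdist_le_max_set_excess[OF t'(1)])
  moreover obtain \<tau> where "\<tau> \<in> max_set a b u" "infdist t (max_set a b u) = dist t \<tau>"
    using infdist_attains_inf[OF compact_imp_closed[OF compact_max_set[OF cont]] max_set_nonempty[OF ab cont]]
    by blast
  ultimately show ?thesis by (auto simp: dist_real_def)
qed

lemma max_set_SUP:
  fixes h :: "real \<Rightarrow> real"
  assumes "continuous_on {a..b} h"
  shows "\<exists>s\<in>max_set a b u. h s = (SUP s\<in>max_set a b u. h s)"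
    and "t \<in> max_set a b u \<Longrightarrow> h t \<le> (SUP s\<in>max_set a b u. h s)"
proof -
  have "continuous_on (max_set a b u) h"
    by (rule continuous_on_subset[OF assms]) (auto simp: max_set_def)
  from continuous_attains_sup[OF compact_max_set[OF cont] max_set_nonempty[OF ab cont] this]
  obtain s where s: "s \<in> max_set a b u" "\<forall>y\<in>max_set a b u. h y \<le> h s"
    by blast
  then have *: "(SUP s\<in>max_set a b u. h s) = h s"
    by (intro cSup_eq_maximum) auto
  show "\<exists>s\<in>max_set a b u. h s = (SUP s\<in>max_set a b u. h s)"
    unfolding * using s(1) by blast
  show "t \<in> max_set a b u \<Longrightarrow> h t \<le> (SUP s\<in>max_set a b u. h s)"
    unfolding * using s(2) by blast
qed

text \<open>The lower bound tests the perturbed function at a maximiser of \<open>u\<close> where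
  \<open>h\<close> is largest. For the upper bound, a maximiser t of the perturbed function
  contributes at most max u + c * h t, and h t is compared with h at a nearby maximiser of
  \<open>u\<close>. The scale \<open>c\<close> serves two ends: c = 1 gives the Bouligand estimate,
  c tending to 0 the directional derivative.\<close>

lemma max_functional_increment:
  assumes h: "continuous_on {a..b} h" and c: "0 < c"
  defines "D \<equiv> SUP s\<in>max_set a b u. h s"
  shows "c * D \<le> max_functional a b (u + c *\<^sub>R h) - max_functional a b u"
    and "\<exists>t\<in>{a..b}. \<exists>\<tau>\<in>{a..b}. \<bar>t - \<tau>\<bar> \<le> max_set_excess a b u (c * max_norm a b h) \<and>
           max_functional a b (u + c *\<^sub>R h) - max_functional a b u \<le> c * D + c * (h t - h \<tau>)"
proof -
  have ch: "continuous_on {a..b} (c *\<^sub>R h)"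
    unfolding scaleR_fun_def by (intro continuous_intros h)
  have cu: "continuous_on {a..b} (u + c *\<^sub>R h)"
    using cont ch unfolding plus_fun_def by (intro continuous_intros)
  obtain s where s: "s \<in> max_set a b u" "h s = D"
    using max_set_SUP(1)[OF h] unfolding D_def by blast
  have "u s + c * h s \<le> max_functional a b (u + c *\<^sub>R h)"
    using max_functional_upper[OF cu, of s] s by (simp add: max_set_def scaleR_fun_def)
  then show "c * D \<le> max_functional a b (u + c *\<^sub>R h) - max_functional a b u"
    using s by (simp add: max_set_def)
  obtain t where t: "t \<in> max_set a b (u + c *\<^sub>R h)"
    using max_set_nonempty[OF ab cu] by blast
  have "max_norm a b (c *\<^sub>R h) \<le> c * max_norm a b h"
    using c max_norm_upper[OF h] by (intro max_norm_least ab) (simp add: scaleR_fun_def abs_mult)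
  from max_set_perturbed_near[OF ch t this] obtain \<tau> where \<tau>: "\<tau> \<in> max_set a b u"
      "\<bar>t - \<tau>\<bar> \<le> max_set_excess a b u (c * max_norm a b h)"
    by blast
  have "\<tau> \<in> {a..b}" using \<tau>(1) by (simp add: max_set_def)
  have "t \<in> {a..b}" using t by (simp add: max_set_def)
  have "max_functional a b (u + c *\<^sub>R h) = u t + c * h t"
    using t by (simp add: max_set_def scaleR_fun_def)
  moreover have "u t \<le> max_functional a b u"
    by (rule max_functional_upper[OF cont \<open>t \<in> {a..b}\<close>])
  moreover have "c * h \<tau> \<le> c * D"
    using max_set_SUP(2)[OF h \<tau>(1)] c unfolding D_def by simp
  ultimately have "max_functional a b (u + c *\<^sub>R h) - max_functional a b u \<le> c * D + c * (h t - h \<tau>)"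
    by (simp add: algebra_simps)
  then show "\<exists>t\<in>{a..b}. \<exists>\<tau>\<in>{a..b}. \<bar>t - \<tau>\<bar> \<le> max_set_excess a b u (c * max_norm a b h) \<and>
           max_functional a b (u + c *\<^sub>R h) - max_functional a b u \<le> c * D + c * (h t - h \<tau>)"
    using \<open>t \<in> {a..b}\<close> \<open>\<tau> \<in> {a..b}\<close> \<tau>(2) by blast
qed

end

section \<open>Probability measures carried by a maximum set\<close>

lemma interval_measure_facts:
  assumes "sets \<mu> = sets (restrict_space borel {a..b})"
  shows "space \<mu> = {a..b}"
    and "continuous_on {a..b} f \<Longrightarrow> (f :: real \<Rightarrow> real) \<in> borel_measurable \<mu>"
proof -
  show "space \<mu> = {a..b}"
    using sets_eq_imp_space_eq[OF assms] by (simp add: space_restrict_space)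
  show "continuous_on {a..b} f \<Longrightarrow> f \<in> borel_measurable \<mu>"
    using borel_measurable_continuous_on_restrict measurable_cong_sets[OF assms refl] by blast
qed

lemma interval_measure_integrable:
  fixes f :: "real \<Rightarrow> real"
  assumes "sets \<mu> = sets (restrict_space borel {a..b})" "emeasure \<mu> {a..b} = 1"
    and f: "continuous_on {a..b} f"
  shows "integrable \<mu> f"
proof -
  have sp: "space \<mu> = {a..b}" by (rule interval_measure_facts[OF assms(1)])
  then interpret prob_space \<mu> using assms by (intro prob_spaceI) simp
  show ?thesis
    using max_norm_upper[OF f] sp
    by (intro integrable_const_bound[where B = "max_norm a b f"] interval_measure_facts[OF assms(1)] f)
      (auto intro!: AE_I2)
qed

text \<open>The complement of the support is a union of open null sets. By Lindelof's theorem
  countably many of them have the same union, which is therefore null.\<close>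

lemma AE_borel_support:
  assumes "sets \<mu> = sets (restrict_space borel A)" 
  shows "AE t in \<mu>. t \<in> borel_support \<mu>"
proof -
  have sp: "space \<mu> = A"
    using sets_eq_imp_space_eq[OF assms] by (simp add: space_restrict_space)
  have m: "V \<inter> space \<mu> \<in> sets \<mu>" if "open V" for V
    using that unfolding assms sp sets_restrict_space Int_commute[of V] by (intro imageI) simp
  define \<F> where "\<F> = {V. open V \<and> emeasure \<mu> (V \<inter> space \<mu>) = 0}"
  obtain \<F>' where F': "\<F>' \<subseteq> \<F>" "countable \<F>'" "\<Union>\<F>' = \<Union>\<F>"
    using Lindelof[of \<F>] by (auto simp: \<F>_def)
  have "AE t in \<mu>. \<forall>V\<in>\<F>'. t \<notin> V"
  proof (rule AE_ball_countable')
    fix V assume "V \<in> \<F>'"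
    then have "V \<inter> space \<mu> \<in> null_sets \<mu>"
      using F' m by (auto simp: \<F>_def null_sets_def)
    then have "AE t in \<mu>. t \<notin> V \<inter> space \<mu>" by (rule AE_not_in)
    with AE_space show "AE t in \<mu>. t \<notin> V" by eventually_elim blast
  qed (use F' in auto)
  moreover have "t \<in> borel_support \<mu>" if "t \<in> space \<mu>" "\<forall>V\<in>\<F>'. t \<notin> V" for t
  proof -
    have "t \<notin> \<Union>\<F>" using that F' by blast
    then show ?thesis
      using that(1) by (auto simp: borel_support_def \<F>_def zero_less_iff_neq_zero)
  qed
  ultimately have "AE t in \<mu>. t \<in> space \<mu> \<longrightarrow> t \<in> borel_support \<mu>"
    by (auto elim: eventually_mono)
  with AE_space show ?thesis by eventually_elim blast
qed

context
  fixes a b :: real and w :: "real \<Rightarrow> real" and \<mu>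
  assumes \<mu>: "\<mu> \<in> max_measures a b w"
begin

lemma max_measure_facts:
  "sets \<mu> = sets (restrict_space borel {a..b})" "emeasure \<mu> {a..b} = 1"
  "space \<mu> = {a..b}" "AE t in \<mu>. t \<in> max_set a b w"
proof -
  show s: "sets \<mu> = sets (restrict_space borel {a..b})" "emeasure \<mu> {a..b} = 1"
    using \<mu> by (auto simp: max_measures_def)
  then show "space \<mu> = {a..b}" by (intro interval_measure_facts)
  show "AE t in \<mu>. t \<in> max_set a b w"
    using AE_borel_support[OF s(1)] \<mu> by (auto simp: max_measures_def elim: eventually_mono)
qed

lemma max_measure_prob_space: "prob_space \<mu>"
  using max_measure_facts by (intro prob_spaceI) simp

lemma max_measure_integrable: "continuous_on {a..b} f \<Longrightarrow> integrable \<mu> (f :: real \<Rightarrow> real)"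
  by (rule interval_measure_integrable[OF max_measure_facts(1,2)])

lemma max_measure_integral_le:
  fixes f :: "real \<Rightarrow> real"
  assumes "continuous_on {a..b} f" "\<And>t. t \<in> max_set a b w \<Longrightarrow> f t \<le> c"
  shows "(LINT t|\<mu>. f t) \<le> c"
proof -
  interpret prob_space \<mu> by (rule max_measure_prob_space)
  show ?thesis
    by (rule integral_le_const[OF max_measure_integrable[OF assms(1)]])
      (use max_measure_facts(4) assms(2) in \<open>auto elim: eventually_mono\<close>)
qed

lemma max_measure_integral_ge:
  fixes f :: "real \<Rightarrow> real"
  assumes "continuous_on {a..b} f" "\<And>t. t \<in> max_set a b w \<Longrightarrow> c \<le> f t"
  shows "c \<le> (LINT t|\<mu>. f t)"
proof -
  interpret prob_space \<mu> by (rule max_measure_prob_space)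
  show ?thesis
    by (rule integral_ge_const[OF max_measure_integrable[OF assms(1)]])
      (use max_measure_facts(4) assms(2) in \<open>auto elim: eventually_mono\<close>)
qed

lemma max_measure_integral_max:
  "continuous_on {a..b} w \<Longrightarrow> (LINT t|\<mu>. w t) = max_functional a b w"
  by (intro antisym max_measure_integral_le max_measure_integral_ge) (auto simp: max_set_def)

lemma max_measure_integral_bound:
  assumes "continuous_on {a..b} f"
  shows "\<bar>LINT t|\<mu>. f t\<bar> \<le> max_norm a b f"
proof -
  have "\<bar>f t\<bar> \<le> max_norm a b f" if "t \<in> max_set a b w" for t
    using that by (intro max_norm_upper assms) (simp add: max_set_def)
  then have "(LINT t|\<mu>. f t) \<le> max_norm a b f" "- max_norm a b f \<le> (LINT t|\<mu>. f t)"
    by (intro max_measure_integral_le max_measure_integral_ge assms; fastforce)+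
  then show ?thesis by linarith
qed

end

lemma max_measures_nonempty:
  assumes "a \<le> b" "continuous_on {a..b} w"
  shows "max_measures a b w \<noteq> {}"
proof -
  obtain s where s: "s \<in> max_set a b w" using max_set_nonempty[OF assms] by blast
  define \<mu> :: "real measure" where "\<mu> = return (restrict_space borel {a..b}) s"
  have s': "s \<in> {a..b}" using s by (simp add: max_set_def)
  \<comment> \<open>The complement of s is an open null set of the Dirac measure, so no other point
    lies in the support.\<close>
  have "t = s" if "t \<in> borel_support \<mu>" for t
  proof (rule ccontr)
    assume "t \<noteq> s"
    have sp: "space \<mu> = {a..b}" by (rule interval_measure_facts) (simp add: \<mu>_def)
    have "(- {s}) \<inter> {a..b} \<in> sets (restrict_space borel {a..b})"
      unfolding sets_restrict_space Int_commute[of "- {s}"] by (intro imageI) auto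
    then have "emeasure \<mu> ((- {s}) \<inter> space \<mu>) = 0"
      unfolding sp by (simp add: \<mu>_def)
    moreover have "open (- {s})" "t \<in> - {s}" using \<open>t \<noteq> s\<close> by auto
    ultimately show False using that by (auto simp: borel_support_def)
  qed
  then have "\<mu> \<in> max_measures a b w"
    using s s' by (auto simp: max_measures_def \<mu>_def sets_restrict_space_iff)
  then show ?thesis by blast
qed

section \<open>Riesz representation on an interval\<close>

text \<open>The functional is evaluated on the Bernstein polynomials of a function; this expresses it as
  a limit of integrals against discrete probability measures, and Helly's selection theorem
  provides a limit measure.\<close>

lemma Riesz_interval:
  fixes L :: "(real \<Rightarrow> real) \<Rightarrow> real"
  assumes ab: "a < b"
    and add: "\<And>f g. f \<in> C_space a b \<Longrightarrow> g \<in> C_space a b \<Longrightarrow> L (f + g) = L f + L g"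
    and scale: "\<And>c f. f \<in> C_space a b \<Longrightarrow> L (c *\<^sub>R f) = c * L f"
    and pos: "\<And>f. f \<in> C_space a b \<Longrightarrow> (\<And>t. t \<in> {a..b} \<Longrightarrow> 0 \<le> f t) \<Longrightarrow> 0 \<le> L f"
    and one: "L (indicator {a..b}) = 1"
  shows "\<exists>\<mu>. sets \<mu> = sets (restrict_space borel {a..b}) \<and> emeasure \<mu> {a..b} = 1 \<and>
           (\<forall>f\<in>C_space a b. (LINT s|\<mu>. f s) = L f)"
proof -
  have C_zero: "(0 :: real \<Rightarrow> real) \<in> C_space a b"
    by (simp add: C_space_def zero_fun_def)
  have L_zero: "L 0 = 0"
    using scale[OF C_zero, of 0] by simp
  have C_sum: "sum F K \<in> C_space a b \<and> L (sum F K) = (\<Sum>k\<in>K. L (F k))"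
    if "finite K" "\<And>k. k \<in> K \<Longrightarrow> F k \<in> C_space a b" for F :: "nat \<Rightarrow> real \<Rightarrow> real" and K
    using that by (induction K rule: finite_induct) (auto simp: C_zero L_zero C_space_add add)
  have mono: "L f \<le> L g" if f: "f \<in> C_space a b" and g: "g \<in> C_space a b"
    and le: "\<And>t. t \<in> {a..b} \<Longrightarrow> f t \<le> g t" for f g
  proof -
    have "0 \<le> L (g + (-1) *\<^sub>R f)"
      using le by (intro pos C_space_add C_space_scale f g) (simp add: scaleR_fun_def)
    then show ?thesis
      using add[OF g C_space_scale[OF f, of "-1"]] scale[OF f, of "-1"] by simp
  qed
  \<comment> \<open>Bernstein polynomials carried from [0,1] to [a,b] and cut off outside, so that
    they belong to \<open>C_space a b\<close>.\<close>
  define B where "B n k = (\<lambda>x. if x \<in> {a..b} then Bernstein n k ((x - a) / (b - a)) else 0)"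
    for n k
  have B_C: "B n k \<in> C_space a b" for n k
  proof -
    have "continuous_on {a..b} (\<lambda>x. Bernstein n k ((x - a) / (b - a)))"
      unfolding Bernstein_def using ab by (intro continuous_intros) auto
    then have "continuous_on {a..b} (B n k)"
      by (rule continuous_on_eq) (simp add: B_def)
    then show ?thesis by (auto simp: C_space_def B_def)
  qed
  have unit: "(x - a) / (b - a) \<in> {0..1}" if "x \<in> {a..b}" for x
    using that ab by (auto simp: field_simps)
  \<comment> \<open>These become the weights of a discrete probability measure: they are nonnegative
    by positivity of \<open>L\<close> and sum to 1 because the Bernstein polynomials form a
    partition of unity.\<close>
  define p where "p n k = L (B n k)" for n k
  have p_nonneg: "0 \<le> p n k" for n k
    unfolding p_def using unit by (intro pos B_C) (auto simp: B_def intro!: Bernstein_nonneg)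
  \<comment> \<open>For n = k = 0 the quotient is 0 / 0 = 0, so the only node is a.\<close>
  define node where "node n k = a + real k / real n * (b - a)" for n k :: nat
  have node_in: "node n k \<in> {a..b}" if "k \<le> n" for n k
  proof -
    have "0 \<le> real k / real n" "real k / real n \<le> 1"
      using that by (auto simp: divide_le_eq_1)
    then have "0 \<le> real k / real n * (b - a)" "real k / real n * (b - a) \<le> 1 * (b - a)"
      using ab by (intro mult_nonneg_nonneg mult_right_mono; simp)+
    then show ?thesis by (simp add: node_def)
  qed
  define T where "T n f = (\<Sum>k\<le>n. f (node n k) *\<^sub>R B n k)" for n and f :: "real \<Rightarrow> real"
  have T_C: "T n f \<in> C_space a b" and L_T: "L (T n f) = (\<Sum>k\<le>n. p n k * f (node n k))" for n f
    using C_sum[of "{..n}" "\<lambda>k. f (node n k) *\<^sub>R B n k"] C_space_scale[OF B_C]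
    by (simp_all add: T_def p_def scale[OF B_C] mult.commute)
  have T_apply: "T n f x = (\<Sum>k\<le>n. f (node n k) * Bernstein n k ((x - a) / (b - a)))"
    if "x \<in> {a..b}" for n f x
  proof -
    have sum_apply: "(\<Sum>k\<in>K. F k) x = (\<Sum>k\<in>K. F k x)"
      for F :: "nat \<Rightarrow> real \<Rightarrow> real" and K
      by (induction K rule: infinite_finite_induct) auto
    show ?thesis using that by (simp add: T_def sum_apply scaleR_fun_def B_def)
  qed
  have p_sum: "(\<Sum>k\<le>n. p n k) = 1" for n
  proof -
    have "T n (\<lambda>_. 1) = indicator {a..b}"
    proof
      fix x show "T n (\<lambda>_. 1) x = indicator {a..b} x"
        using T_apply[of x n "\<lambda>_. 1"] T_C[of n "\<lambda>_. 1"] by (cases "x \<in> {a..b}") (auto simp: C_space_def)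
    qed
    then show ?thesis using L_T[of n "\<lambda>_. 1"] one by simp
  qed
  have T_lim: "(\<lambda>n. L (T n f)) \<longlonglongrightarrow> L f" if f: "f \<in> C_space a b" for f
  proof (rule LIMSEQ_I)
    fix e :: real assume "0 < e"
    have "continuous_on {0..1} (\<lambda>y. f (a + y * (b - a)))"
    proof (rule continuous_on_compose2[of "{a..b}" f])
      show "(\<lambda>y. a + y * (b - a)) ` {0..1} \<subseteq> {a..b}"
      proof (intro image_subsetI)
        fix y :: real assume "y \<in> {0..1}"
        then have "0 \<le> y * (b - a)" "y * (b - a) \<le> b - a"
          using ab by (auto intro: mult_left_le_one_le)
        then show "a + y * (b - a) \<in> {a..b}" by simp
      qed
    qed (use f in \<open>auto simp: C_space_def intro!: continuous_intros\<close>)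
    then obtain N where N: "\<And>n x. N \<le> n \<Longrightarrow> x \<in> {0..1} \<Longrightarrow>
        \<bar>f (a + x * (b - a)) - (\<Sum>k\<le>n. f (a + (k / n) * (b - a)) * Bernstein n k x)\<bar> < e / 2"
      using Bernstein_Weierstrass[of "\<lambda>y. f (a + y * (b - a))" "e / 2"] \<open>0 < e\<close> by auto
    have "norm (L (T n f) - L f) < e" if "N \<le> n" for n
    proof -
      have close: "\<bar>f t - T n f t\<bar> < e / 2" if "t \<in> {a..b}" for t
        using N[OF \<open>N \<le> n\<close> unit[OF that]] ab by (simp add: T_apply[OF that] node_def)
      have bounds: "T n f t \<le> f t + e / 2" "f t \<le> T n f t + e / 2" if "t \<in> {a..b}" for t
        using close[OF that] by linarith+
      have *: "f + (e / 2) *\<^sub>R indicator {a..b} \<in> C_space a b"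
        "T n f + (e / 2) *\<^sub>R indicator {a..b} \<in> C_space a b"
        by (intro C_space_add C_space_scale C_space_indicator f T_C)+
      \<comment> \<open>Positivity and mass one take the place of continuity: functions that differ
        by at most e / 2 on [a,b] have values under \<open>L\<close> that differ by at most e /
        2.\<close>
      have "L (T n f) \<le> L (f + (e / 2) *\<^sub>R indicator {a..b})"
        using bounds(1) by (intro mono T_C *) (simp add: scaleR_fun_def)
      moreover have "L f \<le> L (T n f + (e / 2) *\<^sub>R indicator {a..b})"
        using bounds(2) by (intro mono f *) (simp add: scaleR_fun_def)
      ultimately show ?thesis
        using \<open>0 < e\<close>
        by (simp add: add[OF f C_space_scale[OF C_space_indicator]] add[OF T_C C_space_scale[OF C_space_indicator]] scale[OF C_space_indicator] one)
    qed
    then show "\<exists>N. \<forall>n\<ge>N. norm (L (T n f) - L f) < e" by blast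
  qed
  \<comment> \<open>Point masses \<open>p n k\<close> at the nodes, so that the integral of a Borel
    function f is \<open>L (T n f)\<close>.\<close>
  define \<nu> where "\<nu> n = distr (point_measure {..n} (\<lambda>k. ennreal (p n k))) borel (node n)" for n
  have node_meas: "node n \<in> point_measure {..n} (\<lambda>k. ennreal (p n k)) \<rightarrow>\<^sub>M borel" for n
    by simp
  have point_prob: "prob_space (point_measure {..n} (\<lambda>k. ennreal (p n k)))" for n
    by (intro prob_spaceI)
      (simp add: space_point_measure emeasure_point_measure_finite sum_ennreal p_nonneg p_sum)
  have \<nu>_distr: "real_distribution (\<nu> n)" for n
  proof -
    interpret prob_space "\<nu> n"
      unfolding \<nu>_def by (rule prob_space.prob_space_distr[OF point_prob node_meas])
    show ?thesis by standard (simp_all add: \<nu>_def)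
  qed
  have \<nu>_integral: "(LINT x|\<nu> n. f x) = (\<Sum>k\<le>n. p n k * f (node n k))"
    if "f \<in> borel_measurable borel" for n and f :: "real \<Rightarrow> real"
    unfolding \<nu>_def integral_distr[OF node_meas that]
    by (subst lebesgue_integral_point_measure_finite) (auto simp: p_nonneg)
  have "tight \<nu>"
    unfolding tight_def
  proof (intro conjI allI impI \<nu>_distr)
    fix \<epsilon> :: real assume "0 < \<epsilon>"
    \<comment> \<open>Tightness is phrased with half-open intervals; starting at a - 1 keeps the
      node a inside.\<close>
    have "measure (\<nu> n) {a-1<..b} = 1" for n
    proof -
      interpret P: prob_space "point_measure {..n} (\<lambda>k. ennreal (p n k))" by (rule point_prob)
      have "node n -` {a-1<..b} \<inter> space (point_measure {..n} (\<lambda>k. ennreal (p n k)))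
          = space (point_measure {..n} (\<lambda>k. ennreal (p n k)))"
        using node_in by (force simp: space_point_measure)
      then show ?thesis
        unfolding \<nu>_def by (subst measure_distr[OF node_meas]) (simp_all add: P.prob_space)
    qed
    then show "\<exists>a b. a < b \<and> (\<forall>n. 1 - \<epsilon> < measure (\<nu> n) {a<..b})"
      using \<open>0 < \<epsilon>\<close> ab by (intro exI[of _ "a - 1"] exI[of _ b]) auto
  qed
  then obtain r M where r: "strict_mono (r :: nat \<Rightarrow> nat)" and M: "real_distribution M"
      and lim: "weak_conv_m (\<nu> \<circ> r) M"
    using tight_imp_convergent_subsubsequence[of \<nu> "\<lambda>n. n"] by (auto simp: strict_mono_def o_def)
  interpret M: real_distribution M by (rule M)
  have weak: "(\<lambda>n. LINT x|\<nu> (r n). F x) \<longlonglongrightarrow> (LINT x|M. F x)"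
    if "continuous_on UNIV F" "\<And>x. \<bar>F x\<bar> \<le> K" for F :: "real \<Rightarrow> real" and K
    using weak_conv_imp_integral_bdd_continuous_conv[OF _ M lim, of F K] that \<nu>_distr
    by (auto simp: continuous_on_eq_continuous_at)
  \<comment> \<open>The projection onto [a,b]. Weak convergence is tested with bounded continuous
    functions on the whole line; f composed with c is one, whereas the extension of f by zero may
    jump at a and b.\<close>
  define c where "c x = max a (min b x)" for x
  have c: "continuous_on UNIV c" "c x \<in> {a..b}" "x \<in> {a..b} \<Longrightarrow> c x = x" for x
    using ab by (auto simp: c_def intro!: continuous_intros)
  have AE_in: "AE x in M. x \<in> {a..b}"
  proof -
    \<comment> \<open>The truncated distance to [a,b]: it vanishes at every node, hence its integral
      against the limit measure is zero as well, which confines that measure to [a,b].\<close>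
    define G where "G x = min 1 \<bar>x - c x\<bar>" for x
    have G: "continuous_on UNIV G" "\<bar>G x\<bar> \<le> 1" for x
      unfolding G_def by (auto intro!: continuous_intros c)
    have [measurable]: "G \<in> borel_measurable borel"
      by (rule borel_measurable_continuous_onI[OF G(1)])
    have "(LINT x|\<nu> n. G x) = 0" for n
      by (subst \<nu>_integral) (use node_in c(3) in \<open>auto simp: G_def intro!: sum.neutral\<close>)
    then have "(\<lambda>n. 0) \<longlonglongrightarrow> (LINT x|M. G x)"
      using weak[OF G] by simp
    then have "(LINT x|M. G x) = 0"
      using LIMSEQ_unique tendsto_const by metis
    moreover have "integrable M G"
      by (rule M.integrable_const_bound[where B = 1]) (use G(2) in auto)
    ultimately have "AE x in M. G x = 0"
      using integral_nonneg_eq_0_iff_AE[of M G] by (auto simp: G_def[abs_def])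
    then show ?thesis
    proof eventually_elim
      case (elim x)
      then have "c x = x" by (auto simp: G_def min_def split: if_splits)
      then show ?case using c(2)[of x] by simp
    qed
  qed
  have sets_r: "sets (restrict_space M {a..b}) = sets (restrict_space borel {a..b})"
    by (intro sets_restrict_space_cong) simp
  have "emeasure (restrict_space M {a..b}) {a..b} = 1"
    using AE_in by (subst emeasure_restrict_space) (auto simp: M.emeasure_eq_1_AE)
  moreover have "(LINT s|restrict_space M {a..b}. f s) = L f" if f: "f \<in> C_space a b" for f
  proof -
    have fc: "continuous_on UNIV (\<lambda>x. f (c x))"
      by (rule continuous_on_compose2[OF C_space_continuous[OF f] c(1)]) (use c(2) in auto)
    have meas: "(\<lambda>x. f (c x)) \<in> borel_measurable borel"
      by (rule borel_measurable_continuous_onI[OF fc])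
    have "\<bar>f (c x)\<bar> \<le> max_norm a b f" for x
      by (rule max_norm_upper[OF C_space_continuous[OF f] c(2)])
    note weak[OF fc this]
    moreover have "(LINT x|\<nu> n. f (c x)) = L (T n f)" for n
      unfolding \<nu>_integral[OF meas] L_T by (intro sum.cong) (use node_in c(3) in auto)
    moreover have "(\<lambda>n. L (T (r n) f)) \<longlonglongrightarrow> L f"
      using LIMSEQ_subseq_LIMSEQ[OF T_lim[OF f] r] by (simp add: o_def)
    ultimately have "(LINT x|M. f (c x)) = L f"
      using LIMSEQ_unique by fastforce
    moreover have "(LINT s|restrict_space M {a..b}. f s) = (LINT s|restrict_space M {a..b}. f (c s))"
      by (intro Bochner_Integration.integral_cong refl) (simp add: space_restrict_space c(3))
    moreover have "\<dots> = (LINT s:{a..b}|M. f (c s))"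
      unfolding set_lebesgue_integral_def by (subst integral_restrict_space) simp_all
    moreover have "\<dots> = (LINT x|M. f (c x))"
      unfolding set_lebesgue_integral_def
    proof (rule integral_cong_AE)
      show "AE x in M. indicator {a..b} x *\<^sub>R f (c x) = f (c x)"
        using AE_in by eventually_elim simp
    qed (use meas in simp_all)
    ultimately show ?thesis by simp
  qed
  ultimately show ?thesis using sets_r by blast
qed

section \<open>Sobolev functions are Hoelder continuous\<close>

text \<open>The hat function on [0,2] with peak value 1 at 1, written as a second difference of the
  positive part; its integral is 1.\<close>

definition tent :: "real \<Rightarrow> real" where
  "tent x = max 0 x - 2 * max 0 (x - 1) + max 0 (x - 2)"

text \<open>The antiderivative of \<open>tent\<close>, a continuously differentiable step from 0 to
  1. Squares of positive parts avoid a definition by cases and are differentiable at the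
  kinks.\<close>

definition smooth_step :: "real \<Rightarrow> real" where
  "smooth_step x = ((max 0 x)\<^sup>2 - 2 * (max 0 (x - 1))\<^sup>2 + (max 0 (x - 2))\<^sup>2) / 2"

lemma has_real_derivative_pos_part_square:
  "((\<lambda>x::real. (max 0 x)\<^sup>2) has_real_derivative 2 * max 0 x) (at x)"
proof (cases x "0 :: real" rule: linorder_cases)
  case less
  have "((\<lambda>_. 0) has_real_derivative 2 * max 0 x) (at x)"
    using less by (auto intro!: derivative_eq_intros)
  then show ?thesis
    by (rule has_field_derivative_transform_within_open[of _ _ _ "{..<0}"]) (use less in auto)
next
  case greater
  have "((\<lambda>x. x\<^sup>2) has_real_derivative 2 * max 0 x) (at x)"
    using greater by (auto intro!: derivative_eq_intros)
  then show ?thesis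
    by (rule has_field_derivative_transform_within_open[of _ _ _ "{0<..}"]) (use greater in auto)
next
  case equal
  \<comment> \<open>For h distinct from 0 the difference quotient
    \<open>(max 0 h)\<^sup>2 / h\<close> equals \<open>max 0 h\<close>.\<close>
  have "((\<lambda>h::real. max 0 h) \<longlongrightarrow> max 0 0) (at 0)"
    by (intro tendsto_intros)
  then have "((\<lambda>h::real. (max 0 h)\<^sup>2 / h) \<longlongrightarrow> 0) (at 0)"
    by (rule filterlim_cong[THEN iffD1, rotated -1])
      (auto simp: eventually_at_filter max_def power2_eq_square)
  then show ?thesis
    using equal by (simp add: DERIV_def)
qed

lemma smooth_step_derivative: "(smooth_step has_real_derivative tent x) (at x)"
proof -
  have "((\<lambda>x::real. (max 0 (x - c))\<^sup>2) has_real_derivative 2 * max 0 (x - c)) (at x)" for c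
    using DERIV_shift[of "\<lambda>x. (max 0 x)\<^sup>2" "2 * max 0 (x - c)" x "- c"]
      has_real_derivative_pos_part_square[of "x - c"] by simp
  note d = this[of 1] this[of 2] has_real_derivative_pos_part_square[of x]
  show ?thesis
    unfolding smooth_step_def[abs_def] tent_def
    by (rule DERIV_cong[OF DERIV_cdivide[OF DERIV_add[OF DERIV_diff[OF d(3) DERIV_cmult[OF d(1)]] d(2)]]])
      simp
qed

lemma tent_bounds: "0 \<le> tent x" "x \<le> 0 \<Longrightarrow> tent x = 0" "2 \<le> x \<Longrightarrow> tent x = 0"
  by (auto simp: tent_def max_def)

lemma smooth_step_values: "x \<le> 0 \<Longrightarrow> smooth_step x = 0" "2 \<le> x \<Longrightarrow> smooth_step x = 1"
  by (auto simp: smooth_step_def max_def power2_eq_square algebra_simps)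

lemma smooth_step_bounds: "0 \<le> smooth_step x" "smooth_step x \<le> 1"
proof -
  have mono: "smooth_step x \<le> smooth_step y" if "x \<le> y" for x y
    by (rule DERIV_nonneg_imp_nondecreasing[OF that])
      (use smooth_step_derivative tent_bounds(1) in metis)
  show "0 \<le> smooth_step x"
    using mono[of "min 0 x" x] smooth_step_values(1)[of "min 0 x"] by simp
  show "smooth_step x \<le> 1"
    using mono[of x "max 2 x"] smooth_step_values(2)[of "max 2 x"] by simp
qed

lemma continuous_on_tent: "continuous_on A tent"
  unfolding tent_def[abs_def] by (intro continuous_intros)

lemma continuous_integrable_open_interval:
  fixes f :: "real \<Rightarrow> real"
  assumes "continuous_on {a..b} f"
  shows "integrable (lebesgue_on {a<..<b}) f"
proof -
  have "set_integrable lebesgue {a..b} f"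
    using continuous_imp_integrable_real[OF assms]
    by (simp add: integrable_restrict_space set_integrable_def)
  then have "set_integrable lebesgue {a<..<b} f"
    by (rule set_integrable_subset) auto
  then show ?thesis
    by (simp add: integrable_restrict_space set_integrable_def)
qed

lemma continuous_integral_open_interval:
  fixes f :: "real \<Rightarrow> real"
  assumes "continuous_on {a..b} f"
  shows "(LINT x|lebesgue_on {a<..<b}. f x) = integral {a..b} f"
  using lebesgue_integral_eq_integral[OF continuous_integrable_open_interval[OF assms]]
  by (simp add: integral_open_interval_real)

lemma smooth_step_scaled_derivative:
  assumes "0 < \<epsilon>"
  shows "((\<lambda>x. smooth_step ((x - c) / \<epsilon>)) has_real_derivative tent ((x - c) / \<epsilon>) / \<epsilon>) (at x)"
proof -
  have "((\<lambda>x. (x - c) / \<epsilon>) has_real_derivative 1 / \<epsilon>) (at x)"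
    using assms by (auto intro!: derivative_eq_intros)
  from DERIV_chain2[OF smooth_step_derivative this] show ?thesis by simp
qed

text \<open>The weight is a probability density concentrated on [c, c + 2\<epsilon>]: it is
  nonnegative, and its antiderivative rises from 0 to 1 there. Averaging against it preserves
  pointwise bounds on this interval.\<close>

lemma tent_average:
  fixes u :: "real \<Rightarrow> real"
  assumes \<epsilon>: "0 < \<epsilon>" and c: "a \<le> c" "c + 2 * \<epsilon> \<le> b" and u: "continuous_on {a..b} u"
    and close: "\<And>x. c \<le> x \<Longrightarrow> x \<le> c + 2 * \<epsilon> \<Longrightarrow> \<bar>u x - v\<bar> \<le> d"
  shows "\<bar>(LINT x|lebesgue_on {a<..<b}. u x * (tent ((x - c) / \<epsilon>) / \<epsilon>)) - v\<bar> \<le> d"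
proof -
  let ?M = "lebesgue_on {a<..<b}" and ?w = "\<lambda>x. tent ((x - c) / \<epsilon>) / \<epsilon>"
  have w: "continuous_on A ?w" for A
    by (intro continuous_intros continuous_on_compose2[OF continuous_on_tent[of UNIV]]) (use \<epsilon> in auto)
  have hi: "(?w has_integral smooth_step ((b - c) / \<epsilon>) - smooth_step ((a - c) / \<epsilon>)) {a..b}"
    using smooth_step_scaled_derivative[OF \<epsilon>] c \<epsilon>
    by (intro fundamental_theorem_of_calculus)
      (auto simp flip: has_real_derivative_iff_has_vector_derivative intro: has_field_derivative_at_within)
  have "smooth_step ((b - c) / \<epsilon>) = 1"
    using c \<epsilon> by (intro smooth_step_values(2)) (simp add: field_simps)
  moreover have "smooth_step ((a - c) / \<epsilon>) = 0"
    using c \<epsilon> by (intro smooth_step_values(1)) (simp add: field_simps)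
  ultimately have "integral {a..b} ?w = 1"
    using integral_unique[OF hi] by linarith
  then have w1: "(LINT x|?M. ?w x) = 1"
    by (simp only: continuous_integral_open_interval[OF w])
  have int: "integrable ?M ?w" "integrable ?M (\<lambda>x. u x * ?w x)"
    by (intro continuous_integrable_open_interval continuous_on_mult w u)+
  have w0: "0 \<le> ?w x" for x
    using tent_bounds(1) \<epsilon> by simp
  have supp: "?w x = 0" if "\<not> (c \<le> x \<and> x \<le> c + 2 * \<epsilon>)" for x
    using that \<epsilon> tent_bounds(2,3)[of "(x - c) / \<epsilon>"] by (force simp: field_simps not_le)
  have "(v - d) * ?w x \<le> u x * ?w x \<and> u x * ?w x \<le> (v + d) * ?w x" for x
  proof (cases "c \<le> x \<and> x \<le> c + 2 * \<epsilon>")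
    case True
    then have "v - d \<le> u x" "u x \<le> v + d" using close[of x] by linarith+
    then show ?thesis
      using w0[of x] by (intro conjI mult_right_mono; simp)
  qed (simp only: supp mult_zero_right order_refl simp_thms)
  then have "(LINT x|?M. (v - d) * ?w x) \<le> (LINT x|?M. u x * ?w x)"
    "(LINT x|?M. u x * ?w x) \<le> (LINT x|?M. (v + d) * ?w x)"
    using int by (intro integral_mono integrable_mult_right; simp)+
  moreover have k: "(LINT x|?M. k * ?w x) = k" for k
    by (subst integral_mult_right_zero) (simp only: w1 mult_1_right)
  ultimately show ?thesis unfolding k by linarith
qed

text \<open>Testing with smoothed indicator functions of \<open>[s,t]\<close> whose support is moved into the
  open interval.\<close>

lemma weak_derivative_increment:
  fixes u g :: "real \<Rightarrow> real"
  assumes u: "continuous_on {a..b} u" and st: "a \<le> s" "s < t" "t \<le> b"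
    and g: "integrable (lebesgue_on {a<..<b}) g"
    and weak: "\<And>\<eta>. test_function a b \<eta> \<Longrightarrow>
        (LINT x|lebesgue_on {a<..<b}. u x * deriv \<eta> x) = - (LINT x|lebesgue_on {a<..<b}. g x * \<eta> x)"
  shows "\<bar>u t - u s\<bar> \<le> (LINT x|lebesgue_on {a<..<b}. indicator {s..t} x * \<bar>g x\<bar>)"
proof (rule field_le_epsilon)
  let ?M = "lebesgue_on {a<..<b}"
  fix e :: real assume "0 < e"
  have near: "\<exists>d>0. \<forall>x\<in>{a..b}. \<bar>x - r\<bar> < d \<longrightarrow> \<bar>u x - u r\<bar> < e / 2" if "r \<in> {a..b}" for r
    using u[unfolded continuous_on_iff, rule_format, OF that, of "e / 2"] \<open>0 < e\<close>
    by (simp add: dist_real_def)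
  obtain d1 where d1: "0 < d1" "\<And>x. x \<in> {a..b} \<Longrightarrow> \<bar>x - s\<bar> < d1 \<Longrightarrow> \<bar>u x - u s\<bar> < e / 2"
    using near[of s] st by auto
  obtain d2 where d2: "0 < d2" "\<And>x. x \<in> {a..b} \<Longrightarrow> \<bar>x - t\<bar> < d2 \<Longrightarrow> \<bar>u x - u t\<bar> < e / 2"
    using near[of t] st by auto
  \<comment> \<open>The cut-off rises on [s + \<epsilon>, s + 3\<epsilon>] and falls on
    [t - 3\<epsilon>, t - \<epsilon>]. Four \<epsilon> fit between s and t, so the fall starts only
    after the support has begun and the rise is over where the support ends;
    \<open>3 * \<epsilon>\<close> below d1 and d2 keeps both transitions where u is close to u s and
    u t.\<close>
  define \<epsilon> where "\<epsilon> = min ((t - s) / 4) (min d1 d2 / 4)"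
  have \<epsilon>: "0 < \<epsilon>" "4 * \<epsilon> \<le> t - s" "3 * \<epsilon> < d1" "3 * \<epsilon> < d2"
    using d1(1) d2(1) st by (auto simp: \<epsilon>_def min_def)
  define c1 where "c1 = s + \<epsilon>"
  define c2 where "c2 = t - 3 * \<epsilon>"
  define \<eta> where "\<eta> x = smooth_step ((x - c1) / \<epsilon>) - smooth_step ((x - c2) / \<epsilon>)" for x
  define \<eta>' where "\<eta>' x = tent ((x - c1) / \<epsilon>) / \<epsilon> - tent ((x - c2) / \<epsilon>) / \<epsilon>" for x
  have deriv: "(\<eta> has_real_derivative \<eta>' x) (at x)" for x
    unfolding \<eta>_def[abs_def] \<eta>'_def
    by (intro DERIV_diff smooth_step_scaled_derivative \<epsilon>)
  have w: "continuous_on A (\<lambda>x. tent ((x - c) / \<epsilon>) / \<epsilon>)" for A c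
    by (intro continuous_intros continuous_on_compose2[OF continuous_on_tent[of UNIV]]) (use \<epsilon> in auto)
  have deriv_eq: "deriv \<eta> = \<eta>'"
    using deriv DERIV_imp_deriv by blast
  have supp: "\<eta> x = 0" if "x \<notin> {s + \<epsilon>..t - \<epsilon>}" for x
  proof (cases "x < s + \<epsilon>")
    case True
    then have "(x - c1) / \<epsilon> \<le> 0" "(x - c2) / \<epsilon> \<le> 0"
      using \<epsilon> by (simp_all add: c1_def c2_def field_simps)
    then show ?thesis by (simp add: \<eta>_def smooth_step_values)
  next
    case False
    then have "2 \<le> (x - c1) / \<epsilon>" "2 \<le> (x - c2) / \<epsilon>"
      using \<epsilon> that by (simp_all add: c1_def c2_def field_simps)
    then show ?thesis by (simp add: \<eta>_def smooth_step_values)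
  qed
  have \<eta>_cont: "continuous_on A \<eta>" for A
    using deriv by (meson DERIV_atLeastAtMost_imp_continuous_on DERIV_continuous_on has_field_derivative_at_within)
  have "test_function a b \<eta>"
    unfolding test_function_def
  proof (intro conjI exI[of _ "{s + \<epsilon>..t - \<epsilon>}"] allI impI supp)
    show "\<eta> differentiable_on UNIV"
      using deriv by (auto simp: differentiable_on_def real_differentiable_def)
    show "continuous_on UNIV (deriv \<eta>)"
      unfolding deriv_eq \<eta>'_def[abs_def] by (intro continuous_on_diff w)
  qed (use st \<epsilon> in auto)
  note eq = weak[OF this]
  have abs1: "\<bar>\<eta> x\<bar> \<le> indicator {s..t} x" for x
  proof (cases "x \<in> {s..t}")
    case True
    have "\<bar>\<eta> x\<bar> \<le> 1"
      unfolding \<eta>_def using smooth_step_bounds[of "(x - c1) / \<epsilon>"] smooth_step_bounds[of "(x - c2) / \<epsilon>"]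
      by linarith
    with True show ?thesis by simp
  next
    case False
    then have "x \<notin> {s + \<epsilon>..t - \<epsilon>}" using \<epsilon> by auto
    then show ?thesis by (simp add: supp)
  qed
  have "\<bar>LINT x|?M. g x * \<eta> x\<bar> \<le> (LINT x|?M. indicator {s..t} x * \<bar>g x\<bar>)"
  proof (rule order_trans[OF integral_abs_bound])
    have [measurable]: "\<eta> \<in> borel_measurable ?M" "g \<in> borel_measurable ?M"
      using continuous_integrable_open_interval[OF \<eta>_cont] g by auto
    have gm: "integrable ?M (\<lambda>x. \<bar>g x\<bar>)" using g by simp
    have [measurable]: "(indicator {s..t} :: real \<Rightarrow> real) \<in> borel_measurable ?M"
      by (intro measurable_restrict_space1 borel_measurable_indicator) auto
    have bound: "\<bar>g x * \<eta> x\<bar> \<le> indicator {s..t} x * \<bar>g x\<bar>" for x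
      using mult_right_mono[OF abs1[of x], of "\<bar>g x\<bar>"] by (simp add: abs_mult mult.commute)
    have le: "indicator {s..t} x * \<bar>g x\<bar> \<le> \<bar>g x\<bar>" for x
      by (simp add: indicator_def)
    have i2: "integrable ?M (\<lambda>x. indicator {s..t} x * \<bar>g x\<bar>)"
    proof (rule Bochner_Integration.integrable_bound[OF gm])
      show "AE x in ?M. norm (indicator {s..t} x * \<bar>g x\<bar>) \<le> norm \<bar>g x\<bar>"
        by (intro AE_I2) (simp add: indicator_def)
    qed measurable
    have i1: "integrable ?M (\<lambda>x. \<bar>g x * \<eta> x\<bar>)"
    proof (rule Bochner_Integration.integrable_bound[OF gm])
      show "AE x in ?M. norm \<bar>g x * \<eta> x\<bar> \<le> norm \<bar>g x\<bar>"
        using order_trans[OF bound le] by (intro AE_I2) simp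
    qed measurable
    show "(LINT x|?M. \<bar>g x * \<eta> x\<bar>) \<le> (LINT x|?M. indicator {s..t} x * \<bar>g x\<bar>)"
      by (intro integral_mono i1 i2 bound)
  qed
  \<comment> \<open>The derivative of the cut-off is a difference of two densities near s and near
    t, so its integral against u is u s - u t up to e / 2 from either end.\<close>
  moreover have "(LINT x|?M. u x * \<eta>' x)
      = (LINT x|?M. u x * (tent ((x - c1) / \<epsilon>) / \<epsilon>)) - (LINT x|?M. u x * (tent ((x - c2) / \<epsilon>) / \<epsilon>))"
    unfolding \<eta>'_def right_diff_distrib
    by (intro Bochner_Integration.integral_diff continuous_integrable_open_interval continuous_on_mult u w)
  moreover have "\<bar>(LINT x|?M. u x * (tent ((x - c1) / \<epsilon>) / \<epsilon>)) - u s\<bar> \<le> e / 2"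
  proof (rule tent_average[OF \<epsilon>(1) _ _ u])
    fix x assume "c1 \<le> x" "x \<le> c1 + 2 * \<epsilon>"
    then have "x \<in> {a..b}" "\<bar>x - s\<bar> < d1" using st \<epsilon> by (auto simp: c1_def)
    from d1(2)[OF this] show "\<bar>u x - u s\<bar> \<le> e / 2" by simp
  qed (use st \<epsilon> in \<open>simp_all add: c1_def\<close>)
  moreover have "\<bar>(LINT x|?M. u x * (tent ((x - c2) / \<epsilon>) / \<epsilon>)) - u t\<bar> \<le> e / 2"
  proof (rule tent_average[OF \<epsilon>(1) _ _ u])
    fix x assume "c2 \<le> x" "x \<le> c2 + 2 * \<epsilon>"
    then have "x \<in> {a..b}" "\<bar>x - t\<bar> < d2" using st \<epsilon> by (auto simp: c2_def)
    from d2(2)[OF this] show "\<bar>u x - u t\<bar> \<le> e / 2" by simp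
  qed (use st \<epsilon> in \<open>simp_all add: c2_def\<close>)
  ultimately show "\<bar>u t - u s\<bar> \<le> (LINT x|?M. indicator {s..t} x * \<bar>g x\<bar>) + e"
    using eq unfolding deriv_eq by linarith
qed

section \<open>Integral bounds by L^p norms\<close>

text \<open>Convexity gives the tangent inequality on the open half line. The boundary is checked by
  hand: for A = 0 the left side is 0, for x = 0 it is (1 - q) times \<open>A powr q\<close>, which
  is at most 0.\<close>

lemma powr_tangent:
  fixes x A q :: real
  assumes "1 < q" "0 \<le> x" "0 \<le> A"
  shows "A powr q + q * A powr (q - 1) * (x - A) \<le> x powr q"
proof (cases "x = 0 \<or> A = 0")
  case True
  moreover have "A powr (q - 1) * A = A powr q" if "A \<noteq> 0"
    using that assms powr_add[of A "q - 1" 1] by simp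
  ultimately show ?thesis
    using assms mult_right_mono[of 1 q "A powr q"] by (cases "A = 0") (auto simp: algebra_simps)
next
  case False
  with assms have pos: "0 < A" "0 < x" by auto
  have "((\<lambda>z. z powr q) has_real_derivative q * A powr (q - 1)) (at A within {0<..})"
    by (rule has_field_derivative_at_within[OF has_real_derivative_powr[OF pos(1)]])
  from convex_on_imp_above_tangent[OF powr_convex _ _ _ this, of x]
  have "x powr q - A powr q \<ge> q * A powr (q - 1) * (x - A)"
    using pos assms(1) by (simp add: interior_open)
  then show ?thesis by simp
qed

text \<open>Integrating the tangent of \<open>x\<^sup>q\<close> at the mean value of \<open>f\<close> gives Jensen's
  inequality.\<close>

lemma integral_indicator_le_powr:
  fixes f :: "'a \<Rightarrow> real"
  assumes q: "1 < q" and f: "integrable M f" "\<And>x. 0 \<le> f x"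
    and fq: "integrable M (\<lambda>x. f x powr q)"
    and I: "I \<in> sets M" "emeasure M I \<noteq> \<infinity>"
  shows "(LINT x|M. indicator I x * f x) \<le>
           (LINT x|M. f x powr q) powr (1 / q) * measure M I powr (1 - 1 / q)"
proof -
  define l where "l = measure M I"
  define K where "K = (LINT x|M. indicator I x * f x)"
  define J where "J = (LINT x|M. f x powr q)"
  have ind: "integrable M (indicator I :: 'a \<Rightarrow> real)"
    using I by (intro integrable_real_indicator) (auto simp: top.not_eq_extremum)
  have fi: "integrable M (\<lambda>x. indicator I x * f x)"
    using integrable_mult_indicator[OF I(1) f(1)] by simp
  have K0: "0 \<le> K" and J0: "0 \<le> J"
    unfolding K_def J_def using f(2) by (auto intro!: Bochner_Integration.integral_nonneg)
  show ?thesis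
  proof (cases "l = 0")
    case True
    then have "AE x in M. x \<notin> I"
      using I by (intro AE_not_in) (simp add: l_def null_sets_def emeasure_eq_ennreal_measure)
    then have "K = (LINT x|M. 0)"
      unfolding K_def
      by (intro integral_cong_AE) (use f I in \<open>auto elim!: eventually_mono simp: indicator_def\<close>)
    then show ?thesis using True by (simp add: K_def l_def)
  next
    case False
    then have l: "0 < l" using measure_nonneg[of M I] by (simp add: l_def less_le)
    define A where "A = K / l"
    have A: "0 \<le> A" using K0 l by (simp add: A_def)
    \<comment> \<open>The tangent at the mean \<open>A\<close> of f over I, set to zero off I, where
      it lies below the nonnegative power. By the choice of \<open>A\<close> the term linear in f -
      A integrates to zero over I, which leaves \<open>l * A powr q\<close>.\<close>
    let ?T = "\<lambda>x. (A powr q - q * A powr (q - 1) * A) * indicator I x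
                 + q * A powr (q - 1) * (indicator I x * f x)"
    have "(LINT x|M. ?T x) \<le> J"
      unfolding J_def
    proof (rule integral_mono)
      show "integrable M ?T"
        by (intro Bochner_Integration.integrable_add integrable_mult_right ind fi)
      show "?T x \<le> f x powr q" for x
        using powr_tangent[OF q f(2)[of x] A] by (cases "x \<in> I") (simp_all add: algebra_simps)
    qed (rule fq)
    also have "(LINT x|M. ?T x) = (A powr q - q * A powr (q - 1) * A) * l + q * A powr (q - 1) * K"
      using ind fi I by (simp add: Bochner_Integration.integral_add K_def l_def)
    also have "\<dots> = l * A powr q"
      using l by (simp add: A_def algebra_simps)
    finally have "A powr q \<le> J / l" using l by (simp add: field_simps)
    then have "(A powr q) powr (1 / q) \<le> (J / l) powr (1 / q)"
      using q by (intro powr_mono2) auto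
    then have "A \<le> (J / l) powr (1 / q)"
      using q A by (simp add: powr_powr)
    then have "K \<le> (J / l) powr (1 / q) * l"
      using l by (simp add: A_def field_simps)
    also have "\<dots> = J powr (1 / q) * l powr (1 - 1 / q)"
      using l J0 by (simp add: powr_divide powr_diff)
    finally show ?thesis by (simp add: K_def J_def l_def)
  qed
qed

lemma one_less_enn2real: "1 < p \<Longrightarrow> p \<noteq> \<infinity> \<Longrightarrow> 1 < enn2real p"
  by (cases p) (auto simp: ennreal_less_iff simp flip: ennreal_1)

text \<open>On a finite measure space constants are integrable: for p = \<infinity> the essential
  bound dominates, for finite p the function 1 plus the p-th power does.\<close>

lemma Lp_fun_integrable:
  assumes "finite_measure M" "1 < p" "Lp_fun M p g"
  shows "integrable M g"
proof -
  interpret finite_measure M by fact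
  have [measurable]: "g \<in> borel_measurable M" using assms(3) by (simp add: Lp_fun_def)
  show ?thesis
  proof (cases "p = \<infinity>")
    case True
    then obtain C where "AE x in M. \<bar>g x\<bar> \<le> C" using assms(3) by (auto simp: Lp_fun_def)
    then show ?thesis by (intro integrable_const_bound[of _ C]) auto
  next
    case False
    have q: "1 < enn2real p" by (rule one_less_enn2real[OF assms(2) False])
    have "integrable M (\<lambda>x. 1 + \<bar>g x\<bar> powr enn2real p)"
      using assms(3) False by (simp add: Lp_fun_def)
    then show ?thesis
    proof (rule Bochner_Integration.integrable_bound)
      have "\<bar>y\<bar> \<le> 1 + \<bar>y\<bar> powr enn2real p" for y :: real
      proof (cases "\<bar>y\<bar> \<le> 1")
        case False
        then have "\<bar>y\<bar> powr 1 \<le> \<bar>y\<bar> powr enn2real p" using q by (intro powr_mono) auto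
        with False show ?thesis by simp
      qed (simp add: add_increasing2)
      then show "AE x in M. norm (g x) \<le> norm (1 + \<bar>g x\<bar> powr enn2real p)"
        by (intro AE_I2) (simp add: abs_of_nonneg)
    qed measurable
  qed
qed

lemma Lp_fun_add:
  assumes "0 < p" "Lp_fun M p f" "Lp_fun M p g"
  shows "Lp_fun M p (\<lambda>x. f x + g x)"
proof -
  have [measurable]: "f \<in> borel_measurable M" "g \<in> borel_measurable M"
    using assms by (simp_all add: Lp_fun_def)
  show ?thesis
  proof (cases "p = \<infinity>")
    case True
    then obtain C D where "AE x in M. \<bar>f x\<bar> \<le> C" "AE x in M. \<bar>g x\<bar> \<le> D"
      using assms by (auto simp: Lp_fun_def)
    then have "AE x in M. \<bar>f x + g x\<bar> \<le> C + D" by eventually_elim linarith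
    then show ?thesis using True by (auto simp: Lp_fun_def)
  next
    case False
    define q where "q = enn2real p"
    have q: "0 < q" using assms(1) False by (cases p) (auto simp: q_def)
    have "integrable M (\<lambda>x. 2 powr q * (\<bar>f x\<bar> powr q + \<bar>g x\<bar> powr q))"
      using assms False by (simp add: Lp_fun_def q_def)
    then have "integrable M (\<lambda>x. \<bar>f x + g x\<bar> powr q)"
    proof (rule Bochner_Integration.integrable_bound)
      have "\<bar>y + z\<bar> powr q \<le> 2 powr q * (\<bar>y\<bar> powr q + \<bar>z\<bar> powr q)" for y z :: real
      proof -
        have "\<bar>y + z\<bar> powr q \<le> (2 * max \<bar>y\<bar> \<bar>z\<bar>) powr q"
          using q by (intro powr_mono2) auto
        also have "\<dots> = 2 powr q * max \<bar>y\<bar> \<bar>z\<bar> powr q" by (simp add: powr_mult)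
        also have "\<dots> \<le> 2 powr q * (\<bar>y\<bar> powr q + \<bar>z\<bar> powr q)"
          by (intro mult_left_mono) (auto simp: max_def)
        finally show ?thesis .
      qed
      then show "AE x in M. norm (\<bar>f x + g x\<bar> powr q) \<le> norm (2 powr q * (\<bar>f x\<bar> powr q + \<bar>g x\<bar> powr q))"
        by (intro AE_I2) (simp add: abs_of_nonneg)
    qed measurable
    then show ?thesis using False by (simp add: Lp_fun_def q_def)
  qed
qed

lemma Lp_fun_cmult:
  assumes "Lp_fun M p f"
  shows "Lp_fun M p (\<lambda>x. c * f x)"
proof (cases "p = \<infinity>")
  case True
  then obtain C where "AE x in M. \<bar>f x\<bar> \<le> C" using assms by (auto simp: Lp_fun_def)
  then have "AE x in M. \<bar>c * f x\<bar> \<le> \<bar>c\<bar> * C"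
    by eventually_elim (simp add: abs_mult mult_left_mono)
  then show ?thesis using True assms by (auto simp: Lp_fun_def)
qed (use assms in \<open>auto simp: Lp_fun_def abs_mult powr_mult\<close>)

text \<open>As \<open>real_of_ereal\<close> sends infinite values to 0, the essential supremum must
  first be shown finite. The essential bound controls it from above; since the space is not null,
  the essential supremum of the constant 0 controls it from below.\<close>

lemma AE_le_Lp_norm_infinity:
  assumes "Lp_fun M \<infinity> g" "emeasure M (space M) \<noteq> 0"
  shows "AE x in M. \<bar>g x\<bar> \<le> Lp_norm M \<infinity> g" "0 \<le> Lp_norm M \<infinity> g"
proof -
  have [measurable]: "g \<in> borel_measurable M" using assms(1) by (simp add: Lp_fun_def)
  define E where "E = esssup M (\<lambda>x. ereal \<bar>g x\<bar>)"
  obtain C where C: "AE x in M. \<bar>g x\<bar> \<le> C" using assms(1) by (auto simp: Lp_fun_def)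
  have "E \<le> ereal C"
    unfolding E_def by (rule esssup_I) (use C in auto)
  moreover have "esssup M (\<lambda>x. ereal 0) \<le> E"
    unfolding E_def by (rule esssup_mono) auto
  then have "0 \<le> E" using esssup_const[OF assms(2), of "ereal 0"] by (simp add: zero_ereal_def)
  ultimately obtain r where r: "E = ereal r" "0 \<le> r" by (cases E) auto
  have "AE x in M. ereal \<bar>g x\<bar> \<le> E" unfolding E_def by (rule esssup_AE)
  then show "AE x in M. \<bar>g x\<bar> \<le> Lp_norm M \<infinity> g" "0 \<le> Lp_norm M \<infinity> g"
    using r by (auto simp: Lp_norm_def E_def[symmetric])
qed

definition sobolev_exponent :: "ennreal \<Rightarrow> real" where
  "sobolev_exponent p = (if p = \<infinity> then 1 else 1 - 1 / enn2real p)"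

lemma sobolev_exponent_pos: "1 < p \<Longrightarrow> 0 < sobolev_exponent p"
  using one_less_enn2real[of p] by (auto simp: sobolev_exponent_def)

lemma lebesgue_on_open_interval:
  assumes "a < (b :: real)"
  shows "finite_measure (lebesgue_on {a<..<b})"
    and "emeasure (lebesgue_on {a<..<b}) (space (lebesgue_on {a<..<b})) \<noteq> 0"
proof -
  have "emeasure (lebesgue_on {a<..<b}) (space (lebesgue_on {a<..<b})) = ennreal (b - a)"
    using assms by (simp add: emeasure_restrict_space space_restrict_space)
  then show "finite_measure (lebesgue_on {a<..<b})"
    and "emeasure (lebesgue_on {a<..<b}) (space (lebesgue_on {a<..<b})) \<noteq> 0"
    using assms by (auto intro!: finite_measureI)
qed

text \<open>Hoelder's inequality for \<open>g\<close> against the indicator of [s,t]: for p =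
  \<infinity> by the essential bound, for finite p by Jensen's inequality on the interval.\<close>

lemma Lp_interval_bound:
  fixes g :: "real \<Rightarrow> real"
  assumes ab: "a < b" and st: "a \<le> s" "s < t" "t \<le> b" and p: "1 < p"
    and g: "Lp_fun (lebesgue_on {a<..<b}) p g"
  shows "(LINT x|lebesgue_on {a<..<b}. indicator {s..t} x * \<bar>g x\<bar>)
     \<le> Lp_norm (lebesgue_on {a<..<b}) p g * (t - s) powr sobolev_exponent p"
proof -
  let ?M = "lebesgue_on {a<..<b}"
  interpret finite_measure ?M by (rule lebesgue_on_open_interval[OF ab])
  have int: "integrable ?M (\<lambda>x. \<bar>g x\<bar>)"
    using Lp_fun_integrable[OF finite_measure_axioms p g] by simp
  have [measurable]: "g \<in> borel_measurable ?M" using g by (simp add: Lp_fun_def)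
  \<comment> \<open>When s = a or t = b, the closed interval is not contained in the space. Its
    trace \<open>I\<close> still contains the open interval, which fixes its measure as t -
    s.\<close>
  define I where "I = {s..t} \<inter> {a<..<b}"
  have I: "I \<in> sets ?M" by (auto simp: I_def sets_restrict_space)
  have sub: "{s<..<t} \<subseteq> I" "I \<subseteq> {s..t}" using st by (auto simp: I_def)
  have lI: "I \<in> lmeasurable"
    unfolding I_def by (rule fmeasurable_Int_fmeasurable) auto
  have "measure lebesgue I \<le> measure lebesgue {s..t}"
    by (rule measure_mono_fmeasurable[OF sub(2) fmeasurableD[OF lI]]) simp
  moreover have "measure lebesgue {s<..<t} \<le> measure lebesgue I"
    by (rule measure_mono_fmeasurable[OF sub(1) _ lI]) simp
  moreover have "measure ?M I = measure lebesgue I"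
    by (rule measure_restrict_space) (auto simp: I_def)
  ultimately have mI: "measure ?M I = t - s" using st by simp
  have "I \<inter> {a<..<b} = I" by (auto simp: I_def)
  have eq: "(LINT x|?M. indicator {s..t} x * \<bar>g x\<bar>) = (LINT x|?M. indicator I x * \<bar>g x\<bar>)"
    by (intro Bochner_Integration.integral_cong) (auto simp: I_def indicator_def)
  show ?thesis
  proof (cases "p = \<infinity>")
    case True
    note E = AE_le_Lp_norm_infinity[OF g[unfolded True] lebesgue_on_open_interval(2)[OF ab]]
    have "(LINT x|?M. indicator I x * \<bar>g x\<bar>) \<le> (LINT x|?M. Lp_norm ?M \<infinity> g * indicator I x)"
    proof (rule integral_mono_AE)
      show "integrable ?M (\<lambda>x. indicator I x * \<bar>g x\<bar>)"
        using integrable_mult_indicator[OF I int] by simp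
      show "integrable ?M (\<lambda>x. Lp_norm ?M \<infinity> g * indicator I x)"
        using I by (intro integrable_mult_right integrable_real_indicator) (auto simp: less_top[symmetric])
      show "AE x in ?M. indicator I x * \<bar>g x\<bar> \<le> Lp_norm ?M \<infinity> g * indicator I x"
        using E(1) by eventually_elim (simp add: indicator_def)
    qed
    also have "\<dots> = Lp_norm ?M \<infinity> g * (t - s)"
      using I mI \<open>I \<inter> {a<..<b} = I\<close> by simp
    finally show ?thesis
      using st True unfolding eq by (simp add: sobolev_exponent_def)
  next
    case False
    have "integrable ?M (\<lambda>x. \<bar>g x\<bar> powr enn2real p)"
      using g False by (simp add: Lp_fun_def)
    from integral_indicator_le_powr[OF one_less_enn2real[OF p False] int _ this I]
    show ?thesis
      using False unfolding eq by (simp add: Lp_norm_def sobolev_exponent_def mI)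
  qed
qed

lemma weak_derivative_works:
  "u \<in> sobolev_space a b p \<Longrightarrow> has_weak_derivative a b p u (weak_derivative a b p u)"
  using someI_ex[of "has_weak_derivative a b p u"]
  by (simp add: sobolev_space_def weak_derivative_def)

lemma sobolev_seminorm_nonneg:
  assumes "a < b" "u \<in> sobolev_space a b p"
  shows "0 \<le> sobolev_seminorm a b p u"
proof (cases "p = \<infinity>")
  case True
  have "Lp_fun (lebesgue_on {a<..<b}) \<infinity> (weak_derivative a b p u)"
    using weak_derivative_works[OF assms(2)] True by (simp add: has_weak_derivative_def)
  from AE_le_Lp_norm_infinity(2)[OF this lebesgue_on_open_interval(2)[OF assms(1)]] show ?thesis
    using True by (simp add: sobolev_seminorm_def)
qed (simp add: sobolev_seminorm_def Lp_norm_def)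

text \<open>The one-dimensional Morrey estimate: the increment is at most the integral of the
  absolute weak derivative over [s,t], to which Hoelder's inequality applies.\<close>

lemma sobolev_holder_estimate:
  assumes ab: "a < b" and p: "1 < p" and u: "u \<in> sobolev_space a b p"
    and st: "s \<in> {a..b}" "t \<in> {a..b}"
  shows "\<bar>u t - u s\<bar> \<le> sobolev_seminorm a b p u * \<bar>t - s\<bar> powr sobolev_exponent p"
proof -
  let ?g = "weak_derivative a b p u"
  have w: "has_weak_derivative a b p u ?g" by (rule weak_derivative_works[OF u])
  then have g: "Lp_fun (lebesgue_on {a<..<b}) p ?g" by (simp add: has_weak_derivative_def)
  have c: "continuous_on {a..b} u" using u by (simp add: sobolev_space_def C_space_def)
  have ordered: "\<bar>u t - u s\<bar> \<le> sobolev_seminorm a b p u * (t - s) powr sobolev_exponent p"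
    if "a \<le> s" "s < t" "t \<le> b" for s t
    using weak_derivative_increment[OF c that Lp_fun_integrable[OF lebesgue_on_open_interval(1)[OF ab] p g]]
      Lp_interval_bound[OF ab that p g] w
    unfolding has_weak_derivative_def sobolev_seminorm_def by fastforce
  show ?thesis
    using ordered[of s t] ordered[of t s] st
    by (cases s t rule: linorder_cases) (auto simp: abs_minus_commute)
qed

section \<open>The Sobolev space as a vector space\<close>

text \<open>Splitting the integrals in the weak identity of a sum requires integrable summands. The
  first product is continuous on [a,b]; the second is dominated by the maximum of the absolute test
  function times the absolute value of \<open>g\<close>.\<close>

lemma test_function_integrable:
  fixes u g :: "real \<Rightarrow> real"
  assumes "test_function a b \<eta>"
  shows "continuous_on {a..b} u \<Longrightarrow> integrable (lebesgue_on {a<..<b}) (\<lambda>t. u t * deriv \<eta> t)"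
    and "integrable (lebesgue_on {a<..<b}) g \<Longrightarrow> integrable (lebesgue_on {a<..<b}) (\<lambda>t. g t * \<eta> t)"
proof -
  have d: "continuous_on {a..b} (deriv \<eta>)" "continuous_on {a..b} \<eta>"
    using assms by (auto simp: test_function_def intro: continuous_on_subset differentiable_imp_continuous_on)
  show "continuous_on {a..b} u \<Longrightarrow> integrable (lebesgue_on {a<..<b}) (\<lambda>t. u t * deriv \<eta> t)"
    by (intro continuous_integrable_open_interval continuous_on_mult d)
  assume g: "integrable (lebesgue_on {a<..<b}) g"
  have [measurable]: "\<eta> \<in> borel_measurable (lebesgue_on {a<..<b})" "g \<in> borel_measurable (lebesgue_on {a<..<b})"
    using continuous_integrable_open_interval[OF d(2)] g by auto
  have "integrable (lebesgue_on {a<..<b}) (\<lambda>t. max_norm a b \<eta> * \<bar>g t\<bar>)" using g by simp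
  then show "integrable (lebesgue_on {a<..<b}) (\<lambda>t. g t * \<eta> t)"
  proof (rule Bochner_Integration.integrable_bound)
    have "\<bar>g t * \<eta> t\<bar> \<le> \<bar>max_norm a b \<eta> * \<bar>g t\<bar>\<bar>" if "t \<in> {a..b}" for t
    proof -
      have "\<bar>\<eta> t\<bar> * \<bar>g t\<bar> \<le> \<bar>max_norm a b \<eta>\<bar> * \<bar>g t\<bar>"
        using order_trans[OF max_norm_upper[OF d(2) that] abs_ge_self] by (rule mult_right_mono) simp
      then show ?thesis by (simp add: abs_mult mult.commute)
    qed
    then show "AE t in lebesgue_on {a<..<b}. norm (g t * \<eta> t) \<le> norm (max_norm a b \<eta> * \<bar>g t\<bar>)"
      by (intro AE_I2) (simp add: space_restrict_space)
  qed measurable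
qed

lemma sobolev_space_add:
  assumes ab: "a < b" and p: "1 < p" and u: "u \<in> sobolev_space a b p" and v: "v \<in> sobolev_space a b p"
  shows "u + v \<in> sobolev_space a b p"
proof -
  let ?M = "lebesgue_on {a<..<b}"
  obtain f g where f: "has_weak_derivative a b p u f" and g: "has_weak_derivative a b p v g"
    using u v by (auto simp: sobolev_space_def)
  have uv: "continuous_on {a..b} u" "continuous_on {a..b} v"
    using u v by (simp_all add: sobolev_space_def C_space_def)
  have fg: "integrable ?M f" "integrable ?M g"
    using f g Lp_fun_integrable[OF lebesgue_on_open_interval(1)[OF ab] p]
    by (simp_all add: has_weak_derivative_def)
  have "has_weak_derivative a b p (u + v) (\<lambda>x. f x + g x)"
    unfolding has_weak_derivative_def
  proof (intro conjI allI impI)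
    show "Lp_fun ?M p (\<lambda>x. f x + g x)"
      using f g by (intro Lp_fun_add order.strict_trans[OF zero_less_one p]) (simp_all add: has_weak_derivative_def)
    fix \<eta> assume \<eta>: "test_function a b \<eta>"
    have "(LINT t|?M. (u + v) t * deriv \<eta> t) = (LINT t|?M. u t * deriv \<eta> t) + (LINT t|?M. v t * deriv \<eta> t)"
      using test_function_integrable(1)[OF \<eta>] uv by (simp add: distrib_right Bochner_Integration.integral_add)
    also have "\<dots> = - ((LINT t|?M. f t * \<eta> t) + (LINT t|?M. g t * \<eta> t))"
      using f g \<eta> by (simp add: has_weak_derivative_def)
    also have "\<dots> = - (LINT t|?M. (f t + g t) * \<eta> t)"
      using test_function_integrable(2)[OF \<eta>] fg by (simp add: distrib_right Bochner_Integration.integral_add)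
    finally show "(LINT t|?M. (u + v) t * deriv \<eta> t) = - (LINT t|?M. (f t + g t) * \<eta> t)" .
  qed
  moreover have "u + v \<in> C_space a b"
    using u v by (auto simp: sobolev_space_def C_space_def plus_fun_def intro!: continuous_intros)
  ultimately show ?thesis by (auto simp: sobolev_space_def)
qed

lemma sobolev_space_scale:
  assumes u: "u \<in> sobolev_space a b p"
  shows "c *\<^sub>R u \<in> sobolev_space a b p"
proof -
  obtain f where f: "has_weak_derivative a b p u f"
    using u by (auto simp: sobolev_space_def)
  then have "has_weak_derivative a b p (c *\<^sub>R u) (\<lambda>x. c * f x)"
    by (auto simp: has_weak_derivative_def scaleR_fun_def Lp_fun_cmult mult.assoc)
  moreover have "c *\<^sub>R u \<in> C_space a b"
    using u by (auto simp: sobolev_space_def C_space_def scaleR_fun_def intro!: continuous_intros)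
  ultimately show ?thesis by (auto simp: sobolev_space_def)
qed

lemma sobolev_space_zero: "0 \<in> sobolev_space a b p"
proof -
  have "has_weak_derivative a b p 0 (\<lambda>_. 0)"
    by (auto simp: has_weak_derivative_def Lp_fun_def)
  then show ?thesis by (auto simp: sobolev_space_def C_space_def zero_fun_def)
qed

section \<open>The maximum functional on Hoelder embedded spaces\<close>

lemma max_functional_scale2:
  assumes "a \<le> b" "continuous_on {a..b} u"
  shows "max_functional a b (2 *\<^sub>R u) = 2 * max_functional a b u"
proof (rule antisym)
  have c: "continuous_on {a..b} (2 *\<^sub>R u)"
    unfolding scaleR_fun_def by (intro continuous_intros assms)
  show "max_functional a b (2 *\<^sub>R u) \<le> 2 * max_functional a b u"
    using max_functional_upper[OF assms(2)]
    by (intro max_functional_least assms(1)) (simp add: scaleR_fun_def)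
  obtain s where "s \<in> {a..b}" "u s = max_functional a b u"
    using max_functional_attained[OF assms] by blast
  then show "2 * max_functional a b u \<le> max_functional a b (2 *\<^sub>R u)"
    using max_functional_upper[OF c, of s] by (simp add: scaleR_fun_def)
qed

text \<open>A probability measure on the maximum set integrates u to max u and any v to at most max
  v, which is the subgradient inequality. Conversely, testing a subgradient along u gives L u = max
  u. The nonnegative function max u - u then has integral zero against the representing measure,
  which is therefore concentrated where u is maximal.\<close>

lemma max_derivative_C_space_subdifferential:
  assumes ab: "a < b" and u: "u \<in> C_space a b"
  shows "max_derivative a b (C_space a b) u =
           subdifferential (C_space a b) (max_norm a b) (max_functional a b) u"
proof (intro equalityI subsetI)
  have cu: "continuous_on {a..b} u" by (rule C_space_continuous[OF u])
  fix L assume "L \<in> max_derivative a b (C_space a b) u"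
  then obtain \<mu> where \<mu>: "\<mu> \<in> max_measures a b u"
    and L: "L = restrict (\<lambda>h. LINT s|\<mu>. h s) (C_space a b)"
    by (auto simp: max_derivative_def)
  note int = max_measure_integrable[OF \<mu> C_space_continuous]
  have "L \<in> continuous_linear_maps (C_space a b) (max_norm a b)"
    unfolding continuous_linear_maps_def
  proof (intro CollectI conjI ballI allI exI[of _ 1])
    fix x assume x: "x \<in> C_space a b"
    show "L (x + y) = L x + L y" if "y \<in> C_space a b" for y
      using x that C_space_add[OF x that] Bochner_Integration.integral_add[OF int[OF x] int[OF that]]
      by (simp add: L plus_fun_def)
    show "L (c *\<^sub>R x) = c *\<^sub>R L x" for c
      using x C_space_scale[OF x, of c] by (simp add: L scaleR_fun_def)
    show "norm (L x) \<le> 1 * max_norm a b x"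
      using max_measure_integral_bound[OF \<mu> C_space_continuous[OF x]] x by (simp add: L)
  qed (simp add: L)
  moreover have "max_functional a b u + L (v - u) \<le> max_functional a b v" if v: "v \<in> C_space a b" for v
  proof -
    have "v - u \<in> C_space a b"
      using C_space_add[OF v C_space_scale[OF u, of "-1"]] by simp
    then have "L (v - u) = (LINT s|\<mu>. v s) - (LINT s|\<mu>. u s)"
      using Bochner_Integration.integral_diff[OF int[OF v] int[OF u]] by (simp add: L fun_diff_def)
    moreover have "(LINT s|\<mu>. u s) = max_functional a b u"
      by (rule max_measure_integral_max[OF \<mu> cu])
    moreover have "(LINT s|\<mu>. v s) \<le> max_functional a b v"
      by (rule max_measure_integral_le[OF \<mu> C_space_continuous[OF v]])
        (auto simp: max_set_def intro!: max_functional_upper[OF C_space_continuous[OF v]])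
    ultimately show ?thesis by linarith
  qed
  ultimately show "L \<in> subdifferential (C_space a b) (max_norm a b) (max_functional a b) u"
    by (simp add: subdifferential_def)
next
  have cu: "continuous_on {a..b} u" by (rule C_space_continuous[OF u])
  have ab': "a \<le> b" using ab by simp
  fix L assume L: "L \<in> subdifferential (C_space a b) (max_norm a b) (max_functional a b) u"
  then have ext: "L \<in> extensional (C_space a b)"
    and add: "\<And>x y. x \<in> C_space a b \<Longrightarrow> y \<in> C_space a b \<Longrightarrow> L (x + y) = L x + L y"
    and scale: "\<And>c x. x \<in> C_space a b \<Longrightarrow> L (c *\<^sub>R x) = c * L x"
    and sub: "\<And>v. v \<in> C_space a b \<Longrightarrow> max_functional a b u + L (v - u) \<le> max_functional a b v"
    by (auto simp: subdifferential_def continuous_linear_maps_def)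
  have sub_add: "L h \<le> max_functional a b (u + h) - max_functional a b u" if "h \<in> C_space a b" for h
    using sub[OF C_space_add[OF u that]] by simp
  \<comment> \<open>Subtracting a nonnegative function cannot raise the maximum.\<close>
  have pos: "0 \<le> L f" if f: "f \<in> C_space a b" "\<And>t. t \<in> {a..b} \<Longrightarrow> 0 \<le> f t" for f
  proof -
    have "max_functional a b (u + (-1) *\<^sub>R f) \<le> max_functional a b u"
      using f max_functional_upper[OF cu]
      by (intro max_functional_least ab') (fastforce simp: scaleR_fun_def intro: order_trans[rotated])
    then show ?thesis
      using sub_add[OF C_space_scale[OF f(1), of "-1"]] scale[OF f(1), of "-1"] by simp
  qed
  \<comment> \<open>Adding the constant c raises the maximum by at most c; both signs of c together
    force mass one.\<close>
  have "c * L (indicator {a..b}) \<le> c" for c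
  proof -
    have "max_functional a b (u + c *\<^sub>R indicator {a..b}) \<le> max_functional a b u + c"
      using max_functional_upper[OF cu]
      by (intro max_functional_least ab') (simp add: scaleR_fun_def)
    then show ?thesis
      using sub_add[OF C_space_scale[OF C_space_indicator, of c]] scale[OF C_space_indicator, of c] by simp
  qed
  from this[of 1] this[of "-1"] have one: "L (indicator {a..b}) = 1" by simp
  obtain \<mu> where \<mu>: "sets \<mu> = sets (restrict_space borel {a..b})" "emeasure \<mu> {a..b} = 1"
    and int: "\<And>f. f \<in> C_space a b \<Longrightarrow> (LINT s|\<mu>. f s) = L f"
    using Riesz_interval[OF ab add scale pos one] by blast
  have sp: "space \<mu> = {a..b}" by (rule interval_measure_facts(1)[OF \<mu>(1)])
  interpret prob_space \<mu> using \<mu> sp by (intro prob_spaceI) simp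
  \<comment> \<open>The subgradient inequality at 2u and at 0 encloses \<open>L u\<close>, as the
    maximum of 2u is twice that of u.\<close>
  have Lu: "L u = max_functional a b u"
  proof (rule antisym)
    show "L u \<le> max_functional a b u"
      using sub_add[OF u] max_functional_scale2[OF ab' cu] by (simp add: scaleR_2)
    have "max_functional a b (u + (-1) *\<^sub>R u) \<le> 0"
      by (intro max_functional_least ab') (simp add: scaleR_fun_def)
    then show "max_functional a b u \<le> L u"
      using sub_add[OF C_space_scale[OF u, of "-1"]] scale[OF u, of "-1"] by simp
  qed
  have iu: "integrable \<mu> u" by (rule interval_measure_integrable[OF \<mu> cu])
  have "(LINT s|\<mu>. max_functional a b u - u s) = 0"
    using int[OF u] Lu iu by (simp add: Bochner_Integration.integral_diff prob_space)
  moreover have "AE s in \<mu>. 0 \<le> max_functional a b u - u s"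
    using max_functional_upper[OF cu] sp by (intro AE_I2) simp
  ultimately have AE_max: "AE s in \<mu>. max_functional a b u - u s = 0"
    using iu by (subst (asm) integral_nonneg_eq_0_iff_AE) auto
  have "borel_support \<mu> \<subseteq> max_set a b u"
  proof
    fix t assume t: "t \<in> borel_support \<mu>"
    then have tab: "t \<in> {a..b}" by (simp add: borel_support_def sp)
    show "t \<in> max_set a b u"
    proof (rule ccontr)
      assume "t \<notin> max_set a b u"
      then have less: "u t < max_functional a b u"
        using max_functional_upper[OF cu tab] tab by (auto simp: max_set_def)
      \<comment> \<open>The set where u is below its maximum is relatively open and null, so a point
        of it has an open neighbourhood of measure zero and lies outside the support.\<close>
      obtain V where V: "open V" "V \<inter> {a..b} = u -` {..<max_functional a b u} \<inter> {a..b}"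
        using continuous_on_open_invariant[THEN iffD1, OF cu, rule_format, of "{..<max_functional a b u}"]
        by auto
      have "AE s in \<mu>. s \<notin> V \<inter> {a..b}"
        using AE_max by eventually_elim (use V(2) in fastforce)
      moreover have "V \<inter> {a..b} \<in> sets \<mu>"
        unfolding \<mu>(1) sets_restrict_space Int_commute[of V] using V(1) by (intro imageI) simp
      ultimately have "emeasure \<mu> (V \<inter> space \<mu>) = 0"
        using AE_iff_null_sets[of "V \<inter> {a..b}" \<mu>] by (simp add: sp null_sets_def)
      moreover have "t \<in> V" using V(2) tab less by blast
      ultimately show False using t V(1) by (auto simp: borel_support_def)
    qed
  qed
  then have "\<mu> \<in> max_measures a b u" using \<mu> by (simp add: max_measures_def)
  moreover have "L = restrict (\<lambda>h. LINT s|\<mu>. h s) (C_space a b)"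
    by (rule extensionalityI[OF ext restrict_extensional]) (simp add: int)
  ultimately show "L \<in> max_derivative a b (C_space a b) u"
    by (auto simp: max_derivative_def)
qed

lemma max_derivative_restrict:
  assumes "X \<subseteq> C_space a b"
  shows "max_derivative a b X u = (\<lambda>L. restrict L X) ` max_derivative a b (C_space a b) u"
  using assms by (auto simp: max_derivative_def image_image Int_absorb1 intro!: image_cong)

section \<open>Differentiability from a Hoelder bound\<close>

lemma eventually_at_zero_small:
  "0 < e \<Longrightarrow> eventually (\<lambda>h. h \<in> A \<and> N h < e) (at_zero A N)"
  unfolding at_zero_def by (rule eventually_INF1[of e]) (auto simp: eventually_principal)

text \<open>The common ground of both cases. The Hoelder bound is imposed with \<open>S\<close> and
  not with \<open>N\<close>, because \<open>S h\<close> is the factor in the final estimates; the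
  value at a in \<open>N\<close> restores control of the maximum norm.\<close>

locale holder_embedded_space =
  fixes a b \<beta> :: real and X :: "(real \<Rightarrow> real) set" and N S :: "(real \<Rightarrow> real) \<Rightarrow> real"
  assumes ab: "a < b" and \<beta>: "0 < \<beta>" and X_C: "X \<subseteq> C_space a b"
    and X_zero: "0 \<in> X"
    and X_add: "\<And>u v. u \<in> X \<Longrightarrow> v \<in> X \<Longrightarrow> u + v \<in> X"
    and X_scale: "\<And>c u. u \<in> X \<Longrightarrow> c *\<^sub>R u \<in> X"
    and S_nonneg: "\<And>u. u \<in> X \<Longrightarrow> 0 \<le> S u"
    and S_holder: "\<And>u s t. u \<in> X \<Longrightarrow> s \<in> {a..b} \<Longrightarrow> t \<in> {a..b} \<Longrightarrow>
      \<bar>u t - u s\<bar> \<le> S u * \<bar>t - s\<bar> powr \<beta>"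
    and N_eq: "\<And>u. N u = \<bar>u a\<bar> + S u"
begin

lemma X_cont: "u \<in> X \<Longrightarrow> continuous_on {a..b} u"
  using X_C C_space_continuous by blast

definition \<rho> :: "(real \<Rightarrow> real) \<Rightarrow> real \<Rightarrow> real" where
  "\<rho> u \<delta> = max_set_excess a b u \<delta> powr \<beta>"

lemma holder_le:
  assumes "h \<in> X" "s \<in> {a..b}" "t \<in> {a..b}" "\<bar>t - s\<bar> \<le> r"
  shows "\<bar>h t - h s\<bar> \<le> S h * r powr \<beta>"
proof -
  have "S h * \<bar>t - s\<bar> powr \<beta> \<le> S h * r powr \<beta>"
    using assms S_nonneg \<beta> by (intro mult_left_mono powr_mono2) auto
  with S_holder[OF assms(1-3)] show ?thesis by linarith
qed

lemma \<rho>_nonneg: "0 \<le> \<rho> u \<delta>"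
  by (simp add: \<rho>_def)

text \<open>Two points of [a,b] are at most b - a apart, whence a bound that is uniform in
  u.\<close>

lemma \<rho>_le: "u \<in> X \<Longrightarrow> 0 \<le> \<delta> \<Longrightarrow> \<rho> u \<delta> \<le> (b - a) powr \<beta>"
  unfolding \<rho>_def using ab \<beta> X_cont
  by (intro powr_mono2 max_set_excess_le max_set_excess_nonneg) auto

lemma \<rho>_mono: "u \<in> X \<Longrightarrow> 0 \<le> \<delta> \<Longrightarrow> \<delta> \<le> \<delta>' \<Longrightarrow> \<rho> u \<delta> \<le> \<rho> u \<delta>'"
  unfolding \<rho>_def using ab \<beta> X_cont
  by (intro powr_mono2 max_set_excess_nonneg mono_onD[OF max_set_excess_mono]) auto

lemma \<rho>_tendsto: "u \<in> X \<Longrightarrow> (\<rho> u \<longlongrightarrow> 0) (at_right 0)"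
  unfolding \<rho>_def[abs_def] using ab \<beta> X_cont max_set_excess_nonneg
  by (intro tendsto_zero_powrI[OF max_set_excess_tendsto tendsto_const])
    (auto simp: eventually_at_right_field intro!: exI[of _ 1])

text \<open>From |h t| \<le> |h a| + \<open>S h * (b - a) powr \<beta>\<close>, enlarged to a
  multiple of \<open>N h\<close>.\<close>

definition embedding_const :: real where
  "embedding_const = 1 + (b - a) powr \<beta>"

lemma max_norm_le:
  assumes h: "h \<in> X"
  shows "max_norm a b h \<le> embedding_const * N h"
proof (rule max_norm_least)
  fix t assume t: "t \<in> {a..b}"
  have "\<bar>h t - h a\<bar> \<le> S h * (b - a) powr \<beta>"
    using t ab by (intro holder_le h) auto
  moreover have "0 \<le> (b - a) powr \<beta> * \<bar>h a\<bar>" by simp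
  moreover have "embedding_const * N h = \<bar>h a\<bar> + S h + (b - a) powr \<beta> * \<bar>h a\<bar> + S h * (b - a) powr \<beta>"
    by (simp add: embedding_const_def N_eq algebra_simps)
  ultimately show "\<bar>h t\<bar> \<le> embedding_const * N h"
    using S_nonneg[OF h] by linarith
qed (use ab in simp)

lemma N_bounds: "u \<in> X \<Longrightarrow> S u \<le> N u" "u \<in> X \<Longrightarrow> 0 \<le> N u"
  using S_nonneg by (auto simp: N_eq)

text \<open>The measure sits on maximisers of u + h, so it integrates u + h to max (u + h). The
  terms in h cancel and the error is the integral of u minus max u.\<close>

lemma newton_estimate:
  assumes u: "u \<in> X" and h: "h \<in> X" and L: "L \<in> max_derivative a b X (u + h)"
  shows "\<bar>max_functional a b (u + h) - max_functional a b u - L h\<bar> \<le> \<rho> u (max_norm a b h) * S h"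
proof -
  obtain \<mu> where \<mu>: "\<mu> \<in> max_measures a b (u + h)" and "L = restrict (\<lambda>h. LINT s|\<mu>. h s) X"
    using L by (auto simp: max_derivative_def)
  then have Lh: "L h = (LINT s|\<mu>. h s)" using h by simp
  note cu = X_cont[OF u] and ch = X_cont[OF h] and cuh = X_cont[OF X_add[OF u h]]
  have "max_functional a b (u + h) = (LINT s|\<mu>. u s) + (LINT s|\<mu>. h s)"
    using max_measure_integral_max[OF \<mu> cuh] max_measure_integrable[OF \<mu> cu]
      max_measure_integrable[OF \<mu> ch]
    by (simp add: Bochner_Integration.integral_add)
  moreover have "(LINT s|\<mu>. u s) \<le> max_functional a b u"
    by (rule max_measure_integral_le[OF \<mu> cu]) (auto simp: max_set_def intro!: max_functional_upper cu)
  moreover have "max_functional a b u - \<rho> u (max_norm a b h) * S h \<le> (LINT s|\<mu>. u s)"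
  proof (rule max_measure_integral_ge[OF \<mu> cu])
    fix t assume t: "t \<in> max_set a b (u + h)"
    obtain \<tau> where \<tau>: "\<tau> \<in> max_set a b u" "\<bar>t - \<tau>\<bar> \<le> max_set_excess a b u (max_norm a b h)"
      using max_set_perturbed_near[OF less_imp_le[OF ab] cu ch t order_refl] by blast
    have t': "t \<in> {a..b}" "u t + h t = max_functional a b (u + h)" using t by (simp_all add: max_set_def)
    have \<tau>': "\<tau> \<in> {a..b}" "u \<tau> = max_functional a b u" using \<tau> by (simp_all add: max_set_def)
    have "u \<tau> + h \<tau> \<le> u t + h t"
      using max_functional_upper[OF cuh \<tau>'(1)] t' by simp
    moreover have "\<bar>h t - h \<tau>\<bar> \<le> S h * \<rho> u (max_norm a b h)"
      unfolding \<rho>_def by (rule holder_le[OF h \<tau>'(1) t'(1) \<tau>(2)])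
    ultimately show "max_functional a b u - \<rho> u (max_norm a b h) * S h \<le> u t"
      using \<tau>' by (simp add: mult.commute)
  qed
  ultimately show ?thesis unfolding Lh by linarith
qed

lemma increment_estimate:
  assumes u: "u \<in> X" and h: "h \<in> X" and c: "0 < c"
  defines "D \<equiv> SUP s\<in>max_set a b u. h s"
  shows "0 \<le> max_functional a b (u + c *\<^sub>R h) - max_functional a b u - c * D"
    and "max_functional a b (u + c *\<^sub>R h) - max_functional a b u - c * D
           \<le> c * (\<rho> u (c * max_norm a b h) * S h)"
proof -
  note inc = max_functional_increment[OF less_imp_le[OF ab] X_cont[OF u] X_cont[OF h] c, folded D_def]
  show "0 \<le> max_functional a b (u + c *\<^sub>R h) - max_functional a b u - c * D"
    using inc(1) by simp
  from inc(2) obtain t \<tau> where t: "t \<in> {a..b}" "\<tau> \<in> {a..b}"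
      "\<bar>t - \<tau>\<bar> \<le> max_set_excess a b u (c * max_norm a b h)"
    and le: "max_functional a b (u + c *\<^sub>R h) - max_functional a b u \<le> c * D + c * (h t - h \<tau>)"
    by blast
  have "h t - h \<tau> \<le> \<rho> u (c * max_norm a b h) * S h"
    using holder_le[OF h t(2,1,3)] unfolding \<rho>_def by (simp add: mult.commute)
  then have "c * (h t - h \<tau>) \<le> c * (\<rho> u (c * max_norm a b h) * S h)"
    using c by (intro mult_left_mono) auto
  with le show "max_functional a b (u + c *\<^sub>R h) - max_functional a b u - c * D
           \<le> c * (\<rho> u (c * max_norm a b h) * S h)" by linarith
qed

text \<open>The filter \<open>at_right 0\<close> leaves out \<delta> = 0, which occurs as the
  maximum norm of h = 0. Monotonicity of \<rho> covers this value, at the price of halving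
  \<open>d\<close>.\<close>

lemma \<rho>_eventually_small:
  assumes u: "u \<in> X" and e: "0 < e"
  shows "\<exists>d>0. \<forall>\<delta>. 0 \<le> \<delta> \<longrightarrow> \<delta> < d \<longrightarrow> \<rho> u \<delta> < e"
proof -
  obtain d where d: "0 < d" "\<And>y. 0 < y \<Longrightarrow> y < d \<Longrightarrow> \<rho> u y < e"
    using tendstoD[OF \<rho>_tendsto[OF u] e] \<rho>_nonneg
    by (auto simp: eventually_at_right_field dist_real_def)
  have "\<rho> u \<delta> < e" if "0 \<le> \<delta>" "\<delta> < d / 2" for \<delta>
    using \<rho>_mono[OF u that(1) less_imp_le[OF that(2)]] d(2)[of "d / 2"] d(1) by simp
  then show ?thesis using d(1) by (intro exI[of _ "d / 2"]) auto
qed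

lemma has_dir_derivative_max:
  assumes u: "u \<in> X" and h: "h \<in> X"
  shows "has_dir_derivative (max_functional a b) u h (SUP s\<in>max_set a b u. h s)"
  unfolding has_dir_derivative_def
proof (rule tendstoI)
  let ?D = "SUP s\<in>max_set a b u. h s"
  fix e :: real assume "0 < e"
  have m0: "0 \<le> max_norm a b h" by (rule max_norm_nonneg[OF less_imp_le[OF ab] X_cont[OF h]])
  \<comment> \<open>Adding 1 to \<open>S h\<close>, and below to the maximum norm, keeps the
    divisors positive when these vanish.\<close>
  obtain d where d: "0 < d" "\<And>\<delta>. 0 \<le> \<delta> \<Longrightarrow> \<delta> < d \<Longrightarrow> \<rho> u \<delta> < e / (S h + 1)"
    using \<rho>_eventually_small[OF u, of "e / (S h + 1)"] \<open>0 < e\<close> S_nonneg[OF h] by auto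
  have "dist ((max_functional a b (u + t *\<^sub>R h) - max_functional a b u) /\<^sub>R t) ?D < e"
    if t: "0 < t" "t < d / (max_norm a b h + 1)" for t
  proof -
    note inc = increment_estimate[OF u h t(1)]
    have "t * max_norm a b h \<le> t * (max_norm a b h + 1)" using t by simp
    also have "\<dots> < d" using t m0 by (simp add: field_simps)
    finally have "\<rho> u (t * max_norm a b h) < e / (S h + 1)"
      using t m0 by (intro d(2)) auto
    then have "\<rho> u (t * max_norm a b h) * (S h + 1) < e"
      using S_nonneg[OF h] by (simp add: field_simps)
    moreover have "\<rho> u (t * max_norm a b h) * S h \<le> \<rho> u (t * max_norm a b h) * (S h + 1)"
      using \<rho>_nonneg by (intro mult_left_mono) auto
    ultimately have small: "\<rho> u (t * max_norm a b h) * S h < e" by linarith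
    let ?q = "max_functional a b (u + t *\<^sub>R h) - max_functional a b u"
    have "?q / t - ?D = (?q - t * ?D) / t" using t by (simp add: field_simps)
    moreover have "0 \<le> (?q - t * ?D) / t" using inc(1) t by simp
    moreover have "(?q - t * ?D) / t \<le> \<rho> u (t * max_norm a b h) * S h"
      using inc(2) t by (simp add: field_simps)
    ultimately show ?thesis
      using small by (simp add: dist_real_def divide_inverse mult.commute)
  qed
  moreover have "0 < d / (max_norm a b h + 1)" using d m0 by simp
  ultimately show "\<forall>\<^sub>F t in at_right 0.
      dist ((max_functional a b (u + t *\<^sub>R h) - max_functional a b u) /\<^sub>R t) ?D < e"
    unfolding eventually_at_right_field by blast
qed

lemma dir_derivative_max:
  assumes "u \<in> X" "h \<in> X"
  shows "dir_derivative (max_functional a b) u h = (SUP s\<in>max_set a b u. h s)"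
  unfolding dir_derivative_def
proof (rule the_equality)
  show "has_dir_derivative (max_functional a b) u h (SUP s\<in>max_set a b u. h s)"
    by (rule has_dir_derivative_max[OF assms])
  then show "d = (SUP s\<in>max_set a b u. h s)" if "has_dir_derivative (max_functional a b) u h d" for d
    using that tendsto_unique[OF trivial_limit_at_right_real] unfolding has_dir_derivative_def by blast
qed

lemma bouligand_estimate:
  assumes "u \<in> X" "h \<in> X"
  shows "\<bar>max_functional a b (u + h) - max_functional a b u - dir_derivative (max_functional a b) u h\<bar>
           \<le> \<rho> u (max_norm a b h) * S h"
  using increment_estimate[OF assms, of 1] by (simp add: dir_derivative_max[OF assms])

lemma \<rho>_at_zero:
  assumes u: "u \<in> X"
  shows "((\<lambda>h. \<rho> u (max_norm a b h)) \<longlongrightarrow> 0) (at_zero X N)"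
proof (rule tendstoI)
  fix e :: real assume "0 < e"
  then obtain d where d: "0 < d" "\<And>\<delta>. 0 \<le> \<delta> \<Longrightarrow> \<delta> < d \<Longrightarrow> \<rho> u \<delta> < e"
    using \<rho>_eventually_small[OF u] by blast
  have C: "0 < embedding_const" by (simp add: embedding_const_def add_pos_nonneg)
  then have "\<forall>\<^sub>F h in at_zero X N. h \<in> X \<and> N h < d / embedding_const"
    using d(1) by (intro eventually_at_zero_small) simp
  then show "\<forall>\<^sub>F h in at_zero X N. dist (\<rho> u (max_norm a b h)) 0 < e"
  proof eventually_elim
    case (elim h)
    then have h: "h \<in> X" and "embedding_const * N h < d" using C by (auto simp: field_simps)
    then have "max_norm a b h < d" using max_norm_le[OF h] by linarith
    then show ?case
      using d(2)[OF max_norm_nonneg[OF less_imp_le[OF ab] X_cont[OF h]]] \<rho>_nonneg by simp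
  qed
qed

text \<open>An error of order \<open>S h\<close> is also of order \<open>N h\<close>, since
  \<open>S h\<close> is at most \<open>N h\<close>; when \<open>N h = 0\<close>, the quotient is 0
  by the convention for division.\<close>

lemma quotient_le_\<rho>:
  assumes h: "h \<in> X" and le: "\<bar>r\<bar> \<le> \<rho> u (max_norm a b h) * S h"
  shows "\<bar>r\<bar> / N h \<le> \<rho> u (max_norm a b h)"
proof (cases "N h = 0")
  case False
  then have "0 < N h" using N_bounds(2)[OF h] by simp
  moreover have "\<rho> u (max_norm a b h) * S h \<le> \<rho> u (max_norm a b h) * N h"
    by (intro mult_left_mono N_bounds h \<rho>_nonneg)
  ultimately show ?thesis using le by (simp add: divide_le_eq)
qed (simp add: \<rho>_nonneg)

lemma max_derivative_bound:
  assumes "L \<in> max_derivative a b X u" "x \<in> X"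
  shows "\<bar>L x\<bar> \<le> embedding_const * N x"
proof -
  obtain \<mu> where "\<mu> \<in> max_measures a b u" "L = restrict (\<lambda>h. LINT s|\<mu>. h s) X"
    using assms(1) by (auto simp: max_derivative_def)
  then have "\<bar>L x\<bar> \<le> max_norm a b x"
    using max_measure_integral_bound[OF _ X_cont[OF assms(2)]] assms(2) by simp
  also have "\<dots> \<le> embedding_const * N x" by (rule max_norm_le[OF assms(2)])
  finally show ?thesis .
qed

lemma max_derivative_linear: "max_derivative a b X u \<subseteq> continuous_linear_maps X N"
proof
  fix L assume L: "L \<in> max_derivative a b X u"
  then obtain \<mu> where \<mu>: "\<mu> \<in> max_measures a b u" and L_eq: "L = restrict (\<lambda>h. LINT s|\<mu>. h s) X"
    by (auto simp: max_derivative_def)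
  show "L \<in> continuous_linear_maps X N"
    unfolding continuous_linear_maps_def
  proof (intro CollectI conjI ballI allI exI[of _ embedding_const])
    fix x assume x: "x \<in> X"
    show "L (x + y) = L x + L y" if "y \<in> X" for y
      using x that X_add[OF x that] Bochner_Integration.integral_add
          [OF max_measure_integrable[OF \<mu> X_cont[OF x]] max_measure_integrable[OF \<mu> X_cont[OF that]]]
      by (simp add: L_eq plus_fun_def)
    show "L (c *\<^sub>R x) = c *\<^sub>R L x" for c
      using x X_scale[OF x, of c] by (simp add: L_eq scaleR_fun_def)
    show "norm (L x) \<le> embedding_const * N x"
      using max_derivative_bound[OF L x] by simp
  qed (simp add: L_eq)
qed

lemma newton_derivative_max: "newton_derivative X N X (max_functional a b) (max_derivative a b X)"
  unfolding newton_derivative_def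
proof (intro conjI ballI)
  show "open_in_normed X N X" by (auto simp: open_in_normed_def intro: exI[of _ 1])
  fix u assume u: "u \<in> X"
  have ne: "max_derivative a b X v \<noteq> {}" if "v \<in> X" for v
    using max_measures_nonempty[OF less_imp_le[OF ab] X_cont[OF that]] by (simp add: max_derivative_def)
  then show "max_derivative a b X u \<noteq> {}" using u .
  show "max_derivative a b X u \<subseteq> continuous_linear_maps X N" by (rule max_derivative_linear)
  let ?Q = "\<lambda>h. SUP L\<in>max_derivative a b X (u + h).
      ereal (norm (max_functional a b (u + h) - max_functional a b u - L h) / N h)"
  have bounds: "\<forall>\<^sub>F h in at_zero X N. 0 \<le> ?Q h \<and> ?Q h \<le> ereal (\<rho> u (max_norm a b h))"
    using eventually_at_zero_small[of 1 X N, OF zero_less_one]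
  proof eventually_elim
    case (elim h)
    then have h: "h \<in> X" by simp
    obtain L where L: "L \<in> max_derivative a b X (u + h)" using ne[OF X_add[OF u h]] by blast
    \<comment> \<open>The extended real supremum over an empty set would be minus infinity; an
      element \<open>L\<close> provides the lower bound.\<close>
    have "0 \<le> ?Q h"
      by (rule SUP_upper2[OF L]) (use N_bounds(2)[OF h] in simp)
    moreover have "?Q h \<le> ereal (\<rho> u (max_norm a b h))"
      using quotient_le_\<rho>[OF h newton_estimate[OF u h]] by (intro SUP_least) simp
    ultimately show ?case by simp
  qed
  show "(?Q \<longlongrightarrow> 0) (at_zero X N)"
  proof (rule tendsto_sandwich[of "\<lambda>_. 0"])
    show "((\<lambda>h. ereal (\<rho> u (max_norm a b h))) \<longlongrightarrow> 0) (at_zero X N)"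
      using \<rho>_at_zero[OF u] by (simp add: zero_ereal_def)
  qed (use bounds in \<open>auto elim: eventually_mono\<close>)
qed

lemma globally_bounded_max: "globally_bounded X N X (max_derivative a b X)"
  unfolding globally_bounded_def
\<comment> \<open>All these functionals are bounded by the maximum norm, uniformly in their base
  point, so any radius serves; 1 is taken.\<close>
proof (rule exI[of _ embedding_const], rule ballI, rule exI[of _ 1], intro conjI ballI impI)
  fix v L assume L: "L \<in> max_derivative a b X v"
  have "\<bar>L x\<bar> / N x \<le> embedding_const" if x: "x \<in> X" for x
    using max_derivative_bound[OF L x] N_bounds(2)[OF x]
    by (cases "N x = 0") (auto simp: divide_le_eq embedding_const_def)
  then show "operator_norm X N L \<le> embedding_const"
    unfolding operator_norm_def using X_zero by (intro cSUP_least) auto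
qed simp

lemma bouligand_differentiable_max:
  assumes u: "u \<in> X"
  shows "bouligand_differentiable_at X N (max_functional a b) u"
  unfolding bouligand_differentiable_at_def
proof (intro conjI ballI)
  show "\<exists>d. has_dir_derivative (max_functional a b) u h d" if "h \<in> X" for h
    using has_dir_derivative_max[OF u that] by blast
  have bounds: "\<forall>\<^sub>F h in at_zero X N. 
      0 \<le> norm (max_functional a b (u + h) - max_functional a b u - dir_derivative (max_functional a b) u h) / N h \<and>
      norm (max_functional a b (u + h) - max_functional a b u - dir_derivative (max_functional a b) u h) / N h
        \<le> \<rho> u (max_norm a b h)"
    using eventually_at_zero_small[of 1 X N, OF zero_less_one]
  proof eventually_elim
    case (elim h)
    then have h: "h \<in> X" by simp
    show ?case
      using quotient_le_\<rho>[OF h bouligand_estimate[OF u h]] N_bounds(2)[OF h] by simp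
  qed
  show "((\<lambda>h. norm (max_functional a b (u + h) - max_functional a b u
      - dir_derivative (max_functional a b) u h) / N h) \<longlongrightarrow> 0) (at_zero X N)"
    by (rule tendsto_sandwich[OF _ _ tendsto_const \<rho>_at_zero[OF u]])
      (use bounds in \<open>auto elim: eventually_mono\<close>)
qed

end

section \<open>The Hoelder and Sobolev spaces as instances\<close>

lemma holder_embedded_holder_space:
  assumes "a < b" "0 < \<alpha>"
  shows "holder_embedded_space a b \<alpha> (holder_space a b \<alpha>) (holder_norm a b \<alpha>) (holder_seminorm a b \<alpha>)"
proof
  have quot: "\<bar>u t - u s\<bar> / \<bar>t - s\<bar> powr \<alpha> \<le> holder_seminorm a b \<alpha> u"
    if "u \<in> holder_space a b \<alpha>" "s \<in> {a..b}" "t \<in> {a..b}" "s \<noteq> t" for u s t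
    unfolding holder_seminorm_def
    by (rule cSup_upper) (use that in \<open>auto simp: holder_quotients_def holder_space_def\<close>)
  fix u assume u: "u \<in> holder_space a b \<alpha>"
  \<comment> \<open>As a < b, the endpoints provide a Hoelder quotient, so the supremum dominates a
    nonnegative number.\<close>
  have "0 \<le> \<bar>u b - u a\<bar> / \<bar>b - a\<bar> powr \<alpha>" by simp
  also have "\<dots> \<le> holder_seminorm a b \<alpha> u"
    using assms by (intro quot u) auto
  finally show "0 \<le> holder_seminorm a b \<alpha> u" .
  show "\<bar>u t - u s\<bar> \<le> holder_seminorm a b \<alpha> u * \<bar>t - s\<bar> powr \<alpha>"
    if "s \<in> {a..b}" "t \<in> {a..b}" for s t
    using quot[OF u that] by (cases "s = t") (auto simp: divide_le_eq split: if_splits)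
  obtain K where K: "\<And>s t. s \<in> {a..b} \<Longrightarrow> t \<in> {a..b} \<Longrightarrow> s \<noteq> t \<Longrightarrow> \<bar>u t - u s\<bar> / \<bar>t - s\<bar> powr \<alpha> \<le> K"
    using quot[OF u] by blast
  show "c *\<^sub>R u \<in> holder_space a b \<alpha>" for c
  proof -
    have "bdd_above (holder_quotients a b \<alpha> (c *\<^sub>R u))"
    proof (rule bdd_aboveI[of _ "\<bar>c\<bar> * K"])
      fix x assume "x \<in> holder_quotients a b \<alpha> (c *\<^sub>R u)"
      then obtain s t where st: "s \<in> {a..b}" "t \<in> {a..b}" "s \<noteq> t"
        and x: "x = \<bar>c * u t - c * u s\<bar> / \<bar>t - s\<bar> powr \<alpha>"
        by (auto simp: holder_quotients_def scaleR_fun_def)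
      have "x = \<bar>c\<bar> * (\<bar>u t - u s\<bar> / \<bar>t - s\<bar> powr \<alpha>)"
        unfolding x right_diff_distrib[symmetric] abs_mult by simp
      also have "\<dots> \<le> \<bar>c\<bar> * K" by (intro mult_left_mono K st) simp
      finally show "x \<le> \<bar>c\<bar> * K" .
    qed
    then show ?thesis using u by (simp add: holder_space_def C_space_scale)
  qed
  fix v assume v: "v \<in> holder_space a b \<alpha>"
  have "bdd_above (holder_quotients a b \<alpha> (u + v))"
  proof (rule bdd_aboveI[of _ "holder_seminorm a b \<alpha> u + holder_seminorm a b \<alpha> v"])
    fix x assume "x \<in> holder_quotients a b \<alpha> (u + v)"
    then obtain s t where st: "s \<in> {a..b}" "t \<in> {a..b}" "s \<noteq> t"
      and x: "x = \<bar>u t + v t - (u s + v s)\<bar> / \<bar>t - s\<bar> powr \<alpha>"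
      by (auto simp: holder_quotients_def)
    have "x \<le> (\<bar>u t - u s\<bar> + \<bar>v t - v s\<bar>) / \<bar>t - s\<bar> powr \<alpha>"
      unfolding x by (intro divide_right_mono) auto
    also have "\<dots> \<le> holder_seminorm a b \<alpha> u + holder_seminorm a b \<alpha> v"
      unfolding add_divide_distrib by (intro add_mono quot u v st)
    finally show "x \<le> holder_seminorm a b \<alpha> u + holder_seminorm a b \<alpha> v" .
  qed
  then show "u + v \<in> holder_space a b \<alpha>"
    using u v by (simp add: holder_space_def C_space_add)
next
  have "bdd_above (holder_quotients a b \<alpha> 0)"
    by (rule bdd_aboveI[of _ 0]) (auto simp: holder_quotients_def)
  then show "0 \<in> holder_space a b \<alpha>"
    by (simp add: holder_space_def C_space_def zero_fun_def)
qed (use assms in \<open>auto simp: holder_space_def holder_norm_def\<close>)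

lemma holder_embedded_sobolev_space:
  assumes "a < b" "1 < p"
  shows "holder_embedded_space a b (sobolev_exponent p) (sobolev_space a b p)
           (sobolev_norm a b p) (sobolev_seminorm a b p)"
  by standard
    (use assms in \<open>auto simp: sobolev_norm_def sobolev_space_zero sobolev_space_add sobolev_space_scale
      sobolev_seminorm_nonneg sobolev_exponent_pos intro: sobolev_holder_estimate\<close>,
      auto simp: sobolev_space_def)

theorem proposition3p4:
  fixes a b :: real
    and X :: "(real \<Rightarrow> real) set"
    and N S :: "(real \<Rightarrow> real) \<Rightarrow> real"
  assumes "a < b"
    and "(\<exists>\<alpha>. 0 < \<alpha> \<and> \<alpha> \<le> 1 \<and> X = holder_space a b \<alpha> \<and>
            N = holder_norm a b \<alpha> \<and> S = holder_seminorm a b \<alpha>) \<or>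
         (\<exists>p. 1 < p \<and> X = sobolev_space a b p \<and>
            N = sobolev_norm a b p \<and> S = sobolev_seminorm a b p)"
  shows "(\<forall>u\<in>X. max_derivative a b X u =
            (\<lambda>L. restrict L X) `
              subdifferential (C_space a b) (max_norm a b) (max_functional a b) u) \<and>
         newton_derivative X N X (max_functional a b) (max_derivative a b X) \<and>
         globally_bounded X N X (max_derivative a b X) \<and>
         (\<forall>u\<in>X. bouligand_differentiable_at X N (max_functional a b) u) \<and>
         (\<forall>u\<in>X. \<forall>h\<in>X. dir_derivative (max_functional a b) u h = (SUP s\<in>max_set a b u. h s)) \<and>
         (\<exists>\<rho> :: (real \<Rightarrow> real) \<Rightarrow> real \<Rightarrow> real.
            (\<exists>C. \<forall>u\<in>X. \<forall>\<delta>\<ge>0. \<rho> u \<delta> \<le> C) \<and>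
            (\<forall>u\<in>X.
               (\<forall>\<delta>\<ge>0. 0 \<le> \<rho> u \<delta>) \<and> mono_on {0..} (\<rho> u) \<and> (\<rho> u \<longlongrightarrow> 0) (at_right 0) \<and>
               (\<forall>h\<in>X. \<forall>L\<in>max_derivative a b X (u + h).
                  \<bar>max_functional a b (u + h) - max_functional a b u - L h\<bar>
                    \<le> \<rho> u (max_norm a b h) * S h) \<and>
               (\<forall>h\<in>X.
                  \<bar>max_functional a b (u + h) - max_functional a b u
                     - dir_derivative (max_functional a b) u h\<bar>
                    \<le> \<rho> u (max_norm a b h) * S h)))"
proof -
  obtain \<beta> where "holder_embedded_space a b \<beta> X N S"
    using assms holder_embedded_holder_space holder_embedded_sobolev_space by blast
  then interpret holder_embedded_space a b \<beta> X N S .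
  show ?thesis
  proof (intro conjI ballI exI[of _ \<rho>] exI[of _ "(b - a) powr \<beta>"] allI impI)
    show "max_derivative a b X u = (\<lambda>L. restrict L X) `
        subdifferential (C_space a b) (max_norm a b) (max_functional a b) u" if "u \<in> X" for u
      using that X_C ab
      by (simp only: max_derivative_restrict[OF X_C] max_derivative_C_space_subdifferential subsetD)
    show "mono_on {0..} (\<rho> u)" if "u \<in> X" for u
      using \<rho>_mono[OF that] by (intro mono_onI) auto
  qed (auto intro: newton_derivative_max globally_bounded_max bouligand_differentiable_max
      dir_derivative_max \<rho>_le \<rho>_nonneg \<rho>_tendsto newton_estimate bouligand_estimate)
qed

end
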